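(* Let $(A,\Lambda)$ be any associative form ring, let $(I,\Gamma)$ and $(J,\Delta)$ be two form ideals of $(A,\Lambda)$, and let $n\ge 3$. Then the stability map $$[\operatorname{FU}(2n,I,\Gamma),\operatorname{FU}(2n,J,\Delta)]/\operatorname{EU}(2n,(I,\Gamma)\circ(J,\Delta))\longrightarrow$$ $$[\operatorname{FU}(2(n+1),I,\Gamma),\operatorname{FU}(2(n+1),J,\Delta)]/\operatorname{EU}(2(n+1),(I,\Gamma)\circ(J,\Delta))$$ is surjective.
   Context: Form rings. $A$ is an associative ring with $1$ with an involution $a\mapsto\bar a$ (additive, $\overline{ab}=\bar b\,\bar a$, $\bar{\bar a}=a$), and $\lambda\in\operatorname{Cent}(A)$ is fixed with $\lambda\bar\lambda=1$. Put $\Lambda_{\min}=\{c-\lambda\bar c\mid c\in A\}$, $\Lambda_{\max}=\{c\in A\mid c=-\lambda\bar c\}$. A form parameter $\Lambda$ is an additive subgroup with $\Lambda_{\min}\subseteq\Lambda\subseteq\Lambda_{\max}$ and $c\Lambda\bar c\subseteq\Lambda$ for all $c\in A$; then $(A,\Lambda)$ is a form ring. Form ideals. For a two-sided ideal $I$ with $\bar I=I$ put $\Gamma_{\max}(I)=I\cap\Lambda$ and $\Gamma_{\min}(I)=\{a-\lambda\bar a\mid a\in I\}+\langle ac\bar a\mid a\in I,c\in\Lambda\rangle$ ($\langle\cdot\rangle$ = additive subgroup generated). A form ideal $(I,\Gamma)$ consists of such an $I$ and an additive subgroup $\Gamma$ with $\Gamma_{\min}(I)\subseteq\Gamma\subseteq\Gamma_{\max}(I)$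 and $c\Gamma\bar c\subseteq\Gamma$ for all $c\in A$. The symmetrised product is $(I,\Gamma)\circ(J,\Delta)=(IJ+JI,\ \Gamma_{\min}(IJ+JI)+{}^J\Gamma+{}^I\Delta)$, where ${}^J\Gamma=\langle b\gamma\bar b\mid b\in J,\gamma\in\Gamma\rangle$, ${}^I\Delta=\langle a\delta\bar a\mid a\in I,\delta\in\Delta\rangle$. Elementary subgroups. $\Omega=\{1,\dots,n,-n,\dots,-1\}$ indexes rows and columns of $2n\times 2n$ matrices; $\varepsilon(i)$ is the sign of $i$. For $i\ne\pm j$, $c\in A$: $T_{ij}(c)=e+ce_{ij}-\lambda^{(\varepsilon(j)-\varepsilon(i))/2}\bar c\,e_{-j,-i}$. For $c\in\lambda^{-(\varepsilon(i)+1)/2}\Lambda$: $T_{i,-i}(c)=e+ce_{i,-i}$. For a form ideal write $(I,\Gamma)_{ij}=I$ if $i\ne\pm j$ and $(I,\Gamma)_{i,-i}=\lambda^{-(\varepsilon(i)+1)/2}\Gamma$. $\operatorname{EU}(2n,A,\Lambda)$ is generated by all $T_{ij}(c)$, $c\in(A,\Lambda)_{ij}$; $\operatorname{FU}(2n,I,\Gamma)$ is generated by all $T_{ij}(a)$, $a\in(I,\Gamma)_{ij}$; $\operatorname{EU}(2n,I,\Gamma)$ is the normal closure of $\operatorname{FU}(2n,I,\Gamma)$ in $\operatorname{EU}(2n,A,\Lambda)$. Here $[x,y]=xyx^{-1}y^{-1}$ and $[H,K]$ is the subgroup generated by commutators. It is known that for $n\ge3$, $\operatorname{EU}(2n,(I,\Gamma)\circ(J,\Delta))\le[\operatorname{FU}(2n,I,\Gamma),\operatorname{FU}(2n,J,\Delta)]$.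 The stability map is induced by the standard embedding of $2n\times2n$ matrices into $2(n+1)\times2(n+1)$ matrices which keeps the entries at positions indexed by $\pm1,\dots,\pm n$ and acts as the identity on the basis vectors $e_{n+1},e_{-(n+1)}$ (so $T_{ij}(c)\mapsto T_{ij}(c)$). *)

theory Defs
  imports
    "HOL-Algebra.Generated_Groups"
    "HOL-Library.Set_Algebras"
    "HOL-Computational_Algebra.Group_Closure"
begin

text \<open>
  The sort \<open>{ring, monoid_mult}\<close> describes associative rings with 1. In contrast to \<open>ring_1\<close>
  it does not exclude the zero ring.
\<close>

record 'a form_data =
  bar :: "'a \<Rightarrow> 'a"
  lam :: 'a
  Lam :: "'a set"

definition additive_subgrp :: "'a::ab_group_add set \<Rightarrow> bool" where
  "additive_subgrp S \<longleftrightarrow> 0 \<in> S \<and> (\<forall>x\<in>S. \<forall>y\<in>S. x - y \<in> S)"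

definition Lam_min :: "'a::ring form_data \<Rightarrow> 'a set" where
  "Lam_min R = {c - lam R * bar R c | c. True}"

definition Lam_max :: "'a::ring form_data \<Rightarrow> 'a set" where
  "Lam_max R = {c. c = - (lam R * bar R c)}"

locale form_ring =
  fixes R :: "('a::{ring, monoid_mult}) form_data"
  assumes bar_add: "bar R (a + b) = bar R a + bar R b"
    and bar_mult: "bar R (a * b) = bar R b * bar R a"
    and bar_bar: "bar R (bar R a) = a"
    and lam_central: "lam R * a = a * lam R"
    and lam_bar_lam: "lam R * bar R (lam R) = 1"
    and Lam_subgrp: "additive_subgrp (Lam R)"
    and Lam_min_le: "Lam_min R \<subseteq> Lam R"
    and Lam_le_max: "Lam R \<subseteq> Lam_max R"
    and Lam_conj: "x \<in> Lam R \<Longrightarrow> c * x * bar R c \<in> Lam R"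

definition two_sided_ideal :: "'a::ring set \<Rightarrow> bool" where
  "two_sided_ideal I \<longleftrightarrow>
     additive_subgrp I \<and> (\<forall>c. \<forall>a\<in>I. c * a \<in> I \<and> a * c \<in> I)"

definition Gam_max :: "'a::ring form_data \<Rightarrow> 'a set \<Rightarrow> 'a set" where
  "Gam_max R I = I \<inter> Lam R"

definition Gam_min :: "'a::ring form_data \<Rightarrow> 'a set \<Rightarrow> 'a set" where
  "Gam_min R I =
     {a - lam R * bar R a | a. a \<in> I} + group_closure {a * c * bar R a | a c. a \<in> I \<and> c \<in> Lam R}"

fun form_ideal :: "'a::ring form_data \<Rightarrow> 'a set \<times> 'a set \<Rightarrow> bool" where
  "form_ideal R (I, \<Gamma>) \<longleftrightarrow>
     two_sided_ideal I \<and> bar R ` I = I \<and>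
     additive_subgrp \<Gamma> \<and> Gam_min R I \<subseteq> \<Gamma> \<and> \<Gamma> \<subseteq> Gam_max R I \<and>
     (\<forall>c. \<forall>x\<in>\<Gamma>. c * x * bar R c \<in> \<Gamma>)"

definition ideal_mult :: "'a::ring set \<Rightarrow> 'a set \<Rightarrow> 'a set" where
  "ideal_mult I J = group_closure {a * b | a b. a \<in> I \<and> b \<in> J}"

definition conj_span :: "'a::ring form_data \<Rightarrow> 'a set \<Rightarrow> 'a set \<Rightarrow> 'a set" where
  "conj_span R J \<Gamma> = group_closure {b * x * bar R b | b x. b \<in> J \<and> x \<in> \<Gamma>}"

fun sym_prod ::
  "'a::ring form_data \<Rightarrow> 'a set \<times> 'a set \<Rightarrow> 'a set \<times> 'a set \<Rightarrow> 'a set \<times> 'a set" where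
  "sym_prod R (I, \<Gamma>) (J, \<Delta>) =
     (ideal_mult I J + ideal_mult J I,
      Gam_min R (ideal_mult I J + ideal_mult J I) + conj_span R J \<Gamma> + conj_span R I \<Delta>)"

text \<open>
  Matrices of size 2n with rows and columns indexed by \<open>Om n\<close> are represented by functions
  vanishing outside \<open>Om n \<times> Om n\<close>.
\<close>

definition Om :: "nat \<Rightarrow> int set" where
  "Om n = {1..int n} \<union> {- int n..-1}"

type_synonym 'a imat = "int \<Rightarrow> int \<Rightarrow> 'a"

definition mat_monoid :: "nat \<Rightarrow> ('a::{ring, monoid_mult}) imat monoid" where
  "mat_monoid n =
     \<lparr>carrier = {M. \<forall>i j. i \<notin> Om n \<or> j \<notin> Om n \<longrightarrow> M i j = 0},
      mult = (\<lambda>M N i j. \<Sum>k\<in>Om n. M i k * N k j),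
      one = (\<lambda>i j. if i \<in> Om n \<and> i = j then 1 else 0)\<rparr>"

definition GL :: "nat \<Rightarrow> ('a::{ring, monoid_mult}) imat monoid" where
  "GL n = units_of (mat_monoid n)"

text \<open>Integer powers of \<open>lam R\<close>, whose inverse is \<open>bar R (lam R)\<close>.\<close>

definition lam_pow :: "('a::{ring, monoid_mult}) form_data \<Rightarrow> int \<Rightarrow> 'a" where
  "lam_pow R k = (if 0 \<le> k then lam R ^ nat k else bar R (lam R) ^ nat (- k))"

definition unit_mat :: "int \<Rightarrow> int \<Rightarrow> 'a::zero \<Rightarrow> 'a imat" where
  "unit_mat i j c = (\<lambda>k l. if k = i \<and> l = j then c else 0)"

text \<open>The divisions by 2 below are exact for nonzero indices.\<close>

definition T :: "('a::{ring, monoid_mult}) form_data \<Rightarrow> nat \<Rightarrow> int \<Rightarrow> int \<Rightarrow> 'a \<Rightarrow> 'a imat" where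
  "T R n i j c = (\<lambda>k l.
     if j = - i then \<one>\<^bsub>GL n\<^esub> k l + unit_mat i j c k l
     else \<one>\<^bsub>GL n\<^esub> k l + unit_mat i j c k l
            - unit_mat (- j) (- i) (lam_pow R ((sgn j - sgn i) div 2) * bar R c) k l)"

fun component ::
  "('a::{ring, monoid_mult}) form_data \<Rightarrow> 'a set \<times> 'a set \<Rightarrow> int \<Rightarrow> int \<Rightarrow> 'a set" where
  "component R (I, \<Gamma>) i j =
     (if j = - i then {lam_pow R (- ((sgn i + 1) div 2)) * x | x. x \<in> \<Gamma>} else I)"

definition FU ::
  "('a::{ring, monoid_mult}) form_data \<Rightarrow> nat \<Rightarrow> 'a set \<times> 'a set \<Rightarrow> 'a imat set" where
  "FU R n X = generate (GL n)
     {T R n i j a | i j a. i \<in> Om n \<and> j \<in> Om n \<and> i \<noteq> j \<and> a \<in> component R X i j}"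

definition EU_abs :: "('a::{ring, monoid_mult}) form_data \<Rightarrow> nat \<Rightarrow> 'a imat set" where
  "EU_abs R n = FU R n (UNIV, Lam R)"

definition normal_closure :: "('g, 'm) monoid_scheme \<Rightarrow> 'g set \<Rightarrow> 'g set" where
  "normal_closure G S = \<Inter> {N. N \<lhd> G \<and> S \<subseteq> N}"

definition EU ::
  "('a::{ring, monoid_mult}) form_data \<Rightarrow> nat \<Rightarrow> 'a set \<times> 'a set \<Rightarrow> 'a imat set" where
  "EU R n X = normal_closure ((GL n)\<lparr>carrier := EU_abs R n\<rparr>) (FU R n X)"

definition commutator_subgroup ::
  "('g, 'm) monoid_scheme \<Rightarrow> 'g set \<Rightarrow> 'g set \<Rightarrow> 'g set" where
  "commutator_subgroup G H K = generate G
     {x \<otimes>\<^bsub>G\<^esub> y \<otimes>\<^bsub>G\<^esub> inv\<^bsub>G\<^esub> x \<otimes>\<^bsub>G\<^esub> inv\<^bsub>G\<^esub> y | x y. x \<in> H \<and> y \<in> K}"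

abbreviation FU_comm where
  "FU_comm R n X Y \<equiv> commutator_subgroup (GL n) (FU R n X) (FU R n Y)"

definition FU_quotient ::
  "('a::{ring, monoid_mult}) form_data \<Rightarrow> nat \<Rightarrow> 'a set \<times> 'a set \<Rightarrow> 'a set \<times> 'a set
     \<Rightarrow> 'a imat set monoid" where
  "FU_quotient R n X Y =
     (GL n)\<lparr>carrier := FU_comm R n X Y\<rparr> Mod EU R n (sym_prod R X Y)"

definition stab :: "nat \<Rightarrow> ('a::{ring, monoid_mult}) imat \<Rightarrow> 'a imat" where
  "stab n M = (\<lambda>i j. if i \<in> Om n \<and> j \<in> Om n then M i j
                     else if i = j \<and> \<bar>i\<bar> = int (n + 1) then 1 else 0)"

text \<open>
  The map induced on cosets. The use of \<open>the_elem\<close> is meaningful only if the image coset does not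
  depend on the representative \<open>g\<close>.
\<close>

definition stability_map ::
  "('a::{ring, monoid_mult}) form_data \<Rightarrow> nat \<Rightarrow> 'a set \<times> 'a set \<Rightarrow> 'a set \<times> 'a set
     \<Rightarrow> 'a imat set \<Rightarrow> 'a imat set" where
  "stability_map R n X Y C =
     the_elem ((\<lambda>g. EU R (n + 1) (sym_prod R X Y) #>\<^bsub>GL (n + 1)\<^esub> stab n g) ` C)"

end

theory Submission
  imports Defs
begin

text \<open>
  Why stabilisation is surjective. Put \<open>m = n + 1\<close>, let \<open>E\<close> be the absolute elementary group of
  degree \<open>2m\<close>, and let \<open>Q\<close> be its quotient by the relative elementary subgroup of the symmetrised
  product. Write \<open>t i j a\<close> for the image of \<open>T i j a\<close> in \<open>Q\<close>. In \<open>Q\<close> every transvection whose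
  parameter lies in the symmetrised product is trivial, and this has three consequences.

  First, take a generator \<open>t i j a\<close> of the first group and a generator \<open>t h k b\<close> of the second. If
  the two roots are not opposite, the Chevalley commutator formulas write their commutator as a
  product of transvections with parameters such as \<open>a * b\<close> or \<open>a * b * bar a\<close>, which lie in the
  symmetrised product; so the generators commute in \<open>Q\<close> (lemma \<open>non_opposite_commute\<close>). Only the
  elementary commutators \<open>[t i j a, t j i b]\<close> remain.

  Second, these are central in \<open>Q\<close> (lemmas \<open>short_commutator_central\<close> and
  \<open>long_commutator_central\<close>). Choose an index \<open>p\<close> different from \<open>i, j, - i, - j\<close>. The group is
  generated by the transvections in whose position \<open>p\<close> or \<open>- p\<close> occurs, and such a
  transvection \<open>z\<close> meets at most one of the two factors \<open>x, y\<close>. Conjugation by \<open>z\<close> replaces that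
  factor, say \<open>x\<close>, by \<open>u x\<close>, where \<open>u\<close> again has its parameters in the ideal of \<open>x\<close> and belongs to
  roots not opposite to that of \<open>y\<close>. By the first step \<open>u\<close> commutes with \<open>y\<close>; it commutes with \<open>x\<close>
  because the root of \<open>x\<close> and a root of \<open>u\<close> do not add up to a root. Hence \<open>[u x, y] = [x, y]\<close>.
  Once the elementary commutators are central, commutation is bimultiplicative modulo the subgroup
  that they generate, so this subgroup contains the image of the whole mixed commutator subgroup (lemma \<open>commutators_in_central_subgroup\<close>).

  Third, a central element is fixed by conjugation with Weyl elements. The Weyl element of \<open>i\<close> and
  \<open>p\<close> turns \<open>[t i j a, t j i b]\<close> into \<open>[t p j a, t j p b]\<close>, so an index \<open>i\<close> of absolute value
  \<open>n + 1\<close> can be traded for a smaller one (lemma \<open>opposite_commutator_stable\<close>). Thus the image of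
  the mixed commutator subgroup is generated by elementary commutators that come from degree
  \<open>2n\<close> (theorem \<open>image_FU_comm_stable\<close>), which is surjectivity. The map is well defined
  because stabilisation carries one relative elementary subgroup into the other (lemma \<open>stab_EU\<close>).

  The relations among transvections are obtained from the action on columns: left multiplication
  by a transvection is a pair of row operations, so a relation between products of transvections
  is an identity between compositions of row operations (lemmas \<open>T_prod_eqI\<close> and \<open>t_relation\<close>).
\<close>

section \<open>Indices and matrices\<close>

lemma finite_Om [simp]: "finite (Om n)"
  by (simp add: Om_def)

lemma Om_iff: "i \<in> Om n \<longleftrightarrow> i \<noteq> 0 \<and> \<bar>i\<bar> \<le> int n"
  by (auto simp: Om_def)

lemma Om_uminus [simp]: "- i \<in> Om n \<longleftrightarrow> i \<in> Om n"
  by (simp add: Om_iff)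

lemma Om_nonzero: "i \<in> Om n \<Longrightarrow> i \<noteq> 0"
  by (simp add: Om_iff)

lemma Om_Suc: "i \<in> Om n \<Longrightarrow> i \<in> Om (Suc n)"
  by (simp add: Om_iff)

lemma mat_monoid_simps:
  "carrier (mat_monoid n) = {M. \<forall>i j. i \<notin> Om n \<or> j \<notin> Om n \<longrightarrow> M i j = 0}"
  "M \<otimes>\<^bsub>mat_monoid n\<^esub> N = (\<lambda>i j. \<Sum>k\<in>Om n. M i k * N k j)"
  "\<one>\<^bsub>mat_monoid n\<^esub> = (\<lambda>i j. if i \<in> Om n \<and> i = j then 1 else 0)"
  by (simp_all add: mat_monoid_def)

lemma sum_one_entry:
  fixes f :: "'b \<Rightarrow> 'a::comm_monoid_add"
  assumes "finite S" "k \<in> S" "\<And>l. l \<in> S \<Longrightarrow> l \<noteq> k \<Longrightarrow> f l = 0"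
  shows "sum f S = f k"
  using assms by (metis sum.remove sum.neutral DiffE add.right_neutral insertCI)

lemma monoid_mat_monoid: "monoid (mat_monoid n :: ('a::{ring, monoid_mult}) imat monoid)"
proof (rule monoidI)
  fix x y z :: "'a imat"
  assume xyz: "x \<in> carrier (mat_monoid n)" "y \<in> carrier (mat_monoid n)" "z \<in> carrier (mat_monoid n)"
  have "(\<Sum>k\<in>Om n. (\<Sum>l\<in>Om n. x i l * y l k) * z k j)
      = (\<Sum>k\<in>Om n. x i k * (\<Sum>l\<in>Om n. y k l * z l j))" for i j
    unfolding sum_distrib_left sum_distrib_right mult.assoc by (rule sum.swap)
  then show "x \<otimes>\<^bsub>mat_monoid n\<^esub> y \<otimes>\<^bsub>mat_monoid n\<^esub> z = x \<otimes>\<^bsub>mat_monoid n\<^esub> (y \<otimes>\<^bsub>mat_monoid n\<^esub> z)"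
    by (simp add: mat_monoid_simps)
next
  fix x :: "'a imat" assume x: "x \<in> carrier (mat_monoid n)"
  have "(\<Sum>k\<in>Om n. (if i \<in> Om n \<and> i = k then 1 else 0) * x k j) = x i j" for i j
  proof (cases "i \<in> Om n")
    case True
    then show ?thesis by (subst sum_one_entry[of _ i]) auto
  qed (use x in \<open>simp add: mat_monoid_simps\<close>)
  then show "\<one>\<^bsub>mat_monoid n\<^esub> \<otimes>\<^bsub>mat_monoid n\<^esub> x = x"
    by (simp add: mat_monoid_simps)
  have "(\<Sum>k\<in>Om n. x i k * (if k \<in> Om n \<and> k = j then 1 else 0)) = x i j" for i j
  proof (cases "j \<in> Om n")
    case True
    then show ?thesis by (subst sum_one_entry[of _ j]) auto
  next
    case False
    then have "x i j = 0" using x by (simp add: mat_monoid_simps)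
    moreover have "(\<Sum>k\<in>Om n. x i k * (if k \<in> Om n \<and> k = j then 1 else 0)) = 0"
      by (rule sum.neutral) (use False in auto)
    ultimately show ?thesis by simp
  qed
  then show "x \<otimes>\<^bsub>mat_monoid n\<^esub> \<one>\<^bsub>mat_monoid n\<^esub> = x"
    by (simp add: mat_monoid_simps)
qed (auto simp: mat_monoid_simps)

lemma group_GL: "group (GL n :: ('a::{ring, monoid_mult}) imat monoid)"
  unfolding GL_def by (rule monoid.units_group[OF monoid_mat_monoid])

lemma mult_GL: "mult (GL n) = mult (mat_monoid n)"
  by (simp add: GL_def units_of_mult)

lemma one_GL: "one (GL n) = one (mat_monoid n)"
  by (simp add: GL_def units_of_one)

lemma stab_mat_monoid:
  fixes M N :: "('a::{ring, monoid_mult}) imat"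
  shows "stab n M \<in> carrier (mat_monoid (n + 1))"
    and "stab n (M \<otimes>\<^bsub>mat_monoid n\<^esub> N) = stab n M \<otimes>\<^bsub>mat_monoid (n + 1)\<^esub> stab n N"
    and "stab n \<one>\<^bsub>mat_monoid n\<^esub> = (\<one>\<^bsub>mat_monoid (n + 1)\<^esub> :: 'a imat)"
proof -
  show "stab n M \<in> carrier (mat_monoid (n + 1))"
    by (auto simp: mat_monoid_simps stab_def Om_iff)
  show "stab n \<one>\<^bsub>mat_monoid n\<^esub> = (\<one>\<^bsub>mat_monoid (n + 1)\<^esub> :: 'a imat)"
    by (auto simp: mat_monoid_simps stab_def Om_iff fun_eq_iff)
  have "stab n (\<lambda>i j. \<Sum>k\<in>Om n. M i k * N k j) i j = (\<Sum>k\<in>Om (n+1). stab n M i k * stab n N k j)" for i j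
  proof (cases "i \<in> Om n")
    case True
    have "(\<Sum>k\<in>Om (n+1). stab n M i k * stab n N k j) = (\<Sum>k\<in>Om n. stab n M i k * stab n N k j)"
      by (rule sum.mono_neutral_right) (use True in \<open>auto simp: Om_Suc stab_def\<close>)
    also have "\<dots> = stab n (\<lambda>i j. \<Sum>k\<in>Om n. M i k * N k j) i j"
      using True by (auto simp: stab_def Om_iff intro!: sum.neutral)
    finally show ?thesis by simp
  next
    case i: False
    show ?thesis
    proof (cases "i \<in> Om (n+1)")
      case True
      with i have "\<bar>i\<bar> = int (n + 1)" by (auto simp: Om_iff)
      with i True show ?thesis
        by (subst sum_one_entry[of _ i]) (auto simp: stab_def)
    next
      case False
      with i show ?thesis
        by (subst sum.neutral) (auto simp: stab_def Om_iff)
    qed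
  qed
  then show "stab n (M \<otimes>\<^bsub>mat_monoid n\<^esub> N) = stab n M \<otimes>\<^bsub>mat_monoid (n + 1)\<^esub> stab n N"
    by (simp add: mat_monoid_simps fun_eq_iff)
qed

lemma stab_hom: "stab n \<in> hom (GL n :: ('a::{ring, monoid_mult}) imat monoid) (GL (n + 1))"
proof (rule homI)
  fix x :: "'a imat" assume "x \<in> carrier (GL n)"
  then obtain y where "y \<in> carrier (mat_monoid n)"
    "y \<otimes>\<^bsub>mat_monoid n\<^esub> x = \<one>\<^bsub>mat_monoid n\<^esub>" "x \<otimes>\<^bsub>mat_monoid n\<^esub> y = \<one>\<^bsub>mat_monoid n\<^esub>"
    by (auto simp: GL_def units_of_carrier Units_def)
  then have "stab n y \<otimes>\<^bsub>mat_monoid (n + 1)\<^esub> stab n x = \<one>\<^bsub>mat_monoid (n + 1)\<^esub>"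
    "stab n x \<otimes>\<^bsub>mat_monoid (n + 1)\<^esub> stab n y = \<one>\<^bsub>mat_monoid (n + 1)\<^esub>"
    by (metis stab_mat_monoid(2,3))+
  then show "stab n x \<in> carrier (GL (n + 1))"
    unfolding GL_def units_of_carrier Units_def using stab_mat_monoid(1) by blast
qed (simp add: mult_GL stab_mat_monoid(2))

lemma stab_T:
  fixes R :: "('a::{ring, monoid_mult}) form_data"
  shows "i \<in> Om n \<Longrightarrow> j \<in> Om n \<Longrightarrow> stab n (T R n i j c) = T R (n + 1) i j c"
proof (intro ext)
  fix k l
  assume ij: "i \<in> Om n" "j \<in> Om n"
  show "stab n (T R n i j c) k l = T R (n + 1) i j c k l"
  proof (cases "k \<in> Om n \<and> l \<in> Om n")
    case True
    then show ?thesis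
      by (simp add: stab_def T_def one_GL mat_monoid_simps Om_Suc)
  next
    case False
    then have "unit_mat p q d k l = 0" if "p \<in> Om n" "q \<in> Om n" for p q and d :: 'a
      using that by (auto simp: unit_mat_def)
    then have "T R (n + 1) i j c k l = (if k \<in> Om (n + 1) \<and> k = l then 1 else 0)"
      by (simp only: T_def one_GL mat_monoid_simps ij Om_uminus add_0_right diff_0_right if_cancel
          cong: if_cong)
    moreover have "k \<in> Om (n + 1) \<and> k = l \<longleftrightarrow> k = l \<and> \<bar>k\<bar> = int (n + 1)"
      using False by (auto simp: Om_iff)
    ultimately show ?thesis
      using False unfolding stab_def by presburger
  qed
qed

section \<open>Arithmetic of form rings\<close>

text \<open>A transvection at \<open>(i, j)\<close> has a second nontrivial entry at the dual position \<open>(- j, - i)\<close>;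
  this is the negative of that entry.\<close>

definition dual_entry :: "('a::{ring, monoid_mult}) form_data \<Rightarrow> int \<Rightarrow> int \<Rightarrow> 'a \<Rightarrow> 'a" where
  "dual_entry R i j c = lam_pow R ((sgn j - sgn i) div 2) * bar R c"

context form_ring
begin

lemma bar_zero [simp]: "bar R 0 = 0"
  using bar_add[of 0 0] by simp

lemma bar_minus [simp]: "bar R (- a) = - bar R a"
  using bar_add[of a "- a"] by (simp add: eq_neg_iff_add_eq_0 add.commute)

lemma bar_one [simp]: "bar R 1 = 1"
  by (metis bar_bar bar_mult mult_1_right mult_1_left)

lemma bar_lam_central: "bar R (lam R) * a = a * bar R (lam R)"
  using lam_central[of "bar R a"] by (metis bar_bar bar_mult)

lemma bar_lam_lam: "bar R (lam R) * lam R = 1"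
  using lam_central[of "bar R (lam R)"] by (simp add: lam_bar_lam)

lemma lam_cancel [simp]:
  "lam R * (bar R (lam R) * a) = a" "bar R (lam R) * (lam R * a) = a"
  by (simp_all add: mult.assoc[symmetric] lam_bar_lam bar_lam_lam)

lemma lam_left_commute:
  "a * (lam R * b) = lam R * (a * b)" "a * (bar R (lam R) * b) = bar R (lam R) * (a * b)"
  by (simp_all only: mult.assoc[symmetric] lam_central[of a] bar_lam_central[of a])

lemma dual_entry_cases:
  assumes "i \<noteq> 0" "j \<noteq> 0"
  shows "dual_entry R i j c =
    (if i < 0 \<and> 0 < j then lam R * bar R c
     else if 0 < i \<and> j < 0 then bar R (lam R) * bar R c else bar R c)"
  using assms by (auto simp: dual_entry_def lam_pow_def sgn_if)

lemma dual_entry_add: "dual_entry R i j (a + b) = dual_entry R i j a + dual_entry R i j b"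
  by (simp add: dual_entry_def bar_add distrib_left)

lemma dual_entry_minus [simp]: "dual_entry R i j (- a) = - dual_entry R i j a"
  by (simp add: dual_entry_def)

lemma dual_entry_one:
  "i \<noteq> 0 \<Longrightarrow> j \<noteq> 0 \<Longrightarrow> sgn i = sgn j \<Longrightarrow> dual_entry R i j 1 = 1"
  by (auto simp: dual_entry_cases sgn_if split: if_splits)

text \<open>The dual entries of a product multiply in the opposite order because the involution is an
  anti-automorphism, and the exponents of \<open>lam R\<close> telescope along \<open>i, j, k\<close>. Together with
  involutivity this is all that the commutator formulas need about \<open>bar R\<close> and \<open>lam R\<close>.\<close>

lemma dual_entry_mult:
  assumes "i \<noteq> 0" "j \<noteq> 0" "k \<noteq> 0"
  shows "dual_entry R j k b * dual_entry R i j a = dual_entry R i k (a * b)"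
  using assms
  by (simp add: dual_entry_cases bar_mult mult.assoc lam_left_commute[of "bar R b"])

lemma dual_entry_involution:
  assumes "i \<noteq> 0" "j \<noteq> 0"
  shows "dual_entry R (- j) (- i) (dual_entry R i j c) = c"
  using assms
  by (simp add: dual_entry_cases bar_mult bar_bar mult.assoc bar_lam_central[of c, symmetric]
      lam_central[of c, symmetric])

end

section \<open>Elementary transvections as row operations\<close>

text \<open>The effect of left multiplication by \<open>T R n i j c\<close> on a single column \<open>v\<close>. Columns are
  unrestricted functions, so that identities of row operations do not depend on the degree.\<close>

definition row_op ::
  "('a::{ring, monoid_mult}) form_data \<Rightarrow> int \<Rightarrow> int \<Rightarrow> 'a \<Rightarrow> (int \<Rightarrow> 'a) \<Rightarrow> int \<Rightarrow> 'a" where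
  "row_op R i j c v = (\<lambda>k. v k + (if k = i then c * v j else 0)
      - (if j \<noteq> - i \<and> k = - j then dual_entry R i j c * v (- i) else 0))"

lemma T_mult_left:
  fixes M :: "('a::{ring, monoid_mult}) imat"
  assumes M: "M \<in> carrier (mat_monoid n)" and ij: "i \<in> Om n" "j \<in> Om n"
  shows "T R n i j c \<otimes>\<^bsub>mat_monoid n\<^esub> M = (\<lambda>k l. row_op R i j c (\<lambda>k. M k l) k)"
proof (intro ext)
  fix k l
  have one: "(\<Sum>r\<in>Om n. \<one>\<^bsub>mat_monoid n\<^esub> k r * M r l) = M k l"
    using fun_cong[OF fun_cong[OF monoid.l_one[OF monoid_mat_monoid M], of k], of l]
    by (simp add: mat_monoid_simps)
  have unit: "(\<Sum>r\<in>Om n. unit_mat p q d k r * M r l) = (if k = p then d * M q l else 0)"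
    if "q \<in> Om n" for p q d
    using that by (subst sum_one_entry[of _ q]) (auto simp: unit_mat_def)
  have ij': "- i \<in> Om n" using ij by simp
  show "(T R n i j c \<otimes>\<^bsub>mat_monoid n\<^esub> M) k l = row_op R i j c (\<lambda>k. M k l) k"
    by (cases "j = - i")
      (simp_all add: mat_monoid_simps(2) T_def one_GL row_op_def dual_entry_def
        distrib_right left_diff_distrib sum.distrib sum_subtractf one unit[OF ij(2)] unit[OF ij'])
qed

lemma T_in_mat_monoid:
  "i \<in> Om n \<Longrightarrow> j \<in> Om n \<Longrightarrow> T R n i j c \<in> carrier (mat_monoid n)"
  by (auto simp: mat_monoid_def T_def one_GL unit_mat_def)

definition row_ops ::
  "('a::{ring, monoid_mult}) form_data \<Rightarrow> (int \<times> int \<times> 'a) list \<Rightarrow> (int \<Rightarrow> 'a) \<Rightarrow> int \<Rightarrow> 'a" where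
  "row_ops R ts v = foldr (\<lambda>(i, j, c). row_op R i j c) ts v"

lemma row_ops_simps [simp]:
  "row_ops R [] v = v" "row_ops R ((i, j, c) # ts) v = row_op R i j c (row_ops R ts v)"
  by (simp_all add: row_ops_def)

definition T_prod ::
  "('a::{ring, monoid_mult}) form_data \<Rightarrow> nat \<Rightarrow> (int \<times> int \<times> 'a) list \<Rightarrow> 'a imat" where
  "T_prod R n ts = foldr (\<lambda>(i, j, c) M. T R n i j c \<otimes>\<^bsub>mat_monoid n\<^esub> M) ts \<one>\<^bsub>mat_monoid n\<^esub>"

lemma T_prod_simps [simp]:
  "T_prod R n [] = \<one>\<^bsub>mat_monoid n\<^esub>"
  "T_prod R n ((i, j, c) # ts) = T R n i j c \<otimes>\<^bsub>mat_monoid n\<^esub> T_prod R n ts"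
  by (simp_all add: T_prod_def)

lemma T_prod_eq_row_ops:
  assumes "\<And>i j c. (i, j, c) \<in> set ts \<Longrightarrow> i \<in> Om n \<and> j \<in> Om n"
  shows "T_prod R n ts = (\<lambda>k l. row_ops R ts (\<lambda>k. \<one>\<^bsub>mat_monoid n\<^esub> k l) k)
    \<and> T_prod R n ts \<in> carrier (mat_monoid n)"
  using assms
proof (induction ts)
  case Nil
  show ?case using monoid.one_closed[OF monoid_mat_monoid] by simp
next
  case (Cons t ts)
  obtain i j c where t: "t = (i, j, c)" by (cases t)
  then have ij: "i \<in> Om n" "j \<in> Om n" using Cons.prems by auto
  have IH: "T_prod R n ts = (\<lambda>k l. row_ops R ts (\<lambda>k. \<one>\<^bsub>mat_monoid n\<^esub> k l) k)"
    "T_prod R n ts \<in> carrier (mat_monoid n)"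
    using Cons by auto
  have "T_prod R n (t # ts) = (\<lambda>k l. row_ops R (t # ts) (\<lambda>k. \<one>\<^bsub>mat_monoid n\<^esub> k l) k)"
    unfolding t T_prod_simps T_mult_left[OF IH(2) ij] by (simp add: IH(1))
  moreover have "T_prod R n (t # ts) \<in> carrier (mat_monoid n)"
    unfolding t T_prod_simps by (intro monoid.m_closed[OF monoid_mat_monoid] IH(2) T_in_mat_monoid ij)
  ultimately show ?case ..
qed

text \<open>Applying both products to the columns of the identity matrix recovers the matrices. This
  reduces every relation between transvections to a pointwise identity of functions.\<close>

lemma T_prod_eqI:
  assumes "\<And>i j c. (i, j, c) \<in> set ts \<union> set us \<Longrightarrow> i \<in> Om n \<and> j \<in> Om n"
    and "\<And>v. row_ops R ts v = row_ops R us v"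
  shows "T_prod R n ts = T_prod R n us"
proof -
  note eq = T_prod_eq_row_ops[THEN conjunct1]
  have "T_prod R n ts = (\<lambda>k l. row_ops R ts (\<lambda>k. \<one>\<^bsub>mat_monoid n\<^esub> k l) k)"
    by (rule eq) (use assms(1) in blast)
  also have "\<dots> = T_prod R n us"
    unfolding assms(2) by (rule eq[symmetric]) (use assms(1) in blast)
  finally show ?thesis .
qed

context form_ring
begin

lemma distinct_index:
  fixes i j :: int
  assumes "\<bar>i\<bar> \<noteq> \<bar>j\<bar>"
  shows "i \<noteq> j" "j \<noteq> i" "i \<noteq> - j" "- j \<noteq> i" "j \<noteq> - i" "- i \<noteq> j"
  using assms by auto

lemma nonzero_index:
  fixes i :: int
  assumes "i \<noteq> 0"
  shows "i \<noteq> - i" "- i \<noteq> i"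
  using assms by auto

lemma row_op_sum:
  assumes "i \<noteq> 0" "j \<noteq> 0" "i \<noteq> j"
  shows "row_ops R [(i, j, a), (i, j, b)] v = row_ops R [(i, j, a + b)] v"
proof (rule ext)
  fix k
  show "row_ops R [(i, j, a), (i, j, b)] v k = row_ops R [(i, j, a + b)] v k"
    using assms nonzero_index[OF assms(1)] nonzero_index[OF assms(2)]
    by (simp add: row_op_def algebra_simps dual_entry_add)
qed

lemma row_op_zero: "row_op R i j 0 v = v"
  by (auto simp: row_op_def dual_entry_def fun_eq_iff)

text \<open>Passing to dual positions brings any two adjacent short positions into the form \<open>(i, j)\<close>,
  \<open>(j, k)\<close>, so the commutator formulas need to be known only there.\<close>

lemma row_op_dual:
  assumes "i \<noteq> 0" "j \<noteq> 0" "j \<noteq> - i"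
  shows "row_ops R [(- j, - i, - dual_entry R i j c)] v = row_ops R [(i, j, c)] v"
proof (rule ext)
  fix k
  have "i \<noteq> - j" using assms by auto
  then show "row_ops R [(- j, - i, - dual_entry R i j c)] v k = row_ops R [(i, j, c)] v k"
    using assms by (simp add: row_op_def dual_entry_involution algebra_simps)
qed

text \<open>In matrix terms, the four index inequalities say that the products of the nilpotent parts
  vanish in both orders.\<close>

lemma row_op_commute:
  assumes "j \<noteq> h" "j \<noteq> - k" "i \<noteq> k" "i \<noteq> - h"
  shows "row_ops R [(i, j, a), (h, k, b)] v = row_ops R [(h, k, b), (i, j, a)] v"
proof (rule ext)
  fix l
  have "h \<noteq> j" "k \<noteq> - j" "k \<noteq> i" "h \<noteq> - i" "- k \<noteq> j" "- h \<noteq> i" "- i \<noteq> h" "- j \<noteq> k"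
    using assms by auto
  with assms show "row_ops R [(i, j, a), (h, k, b)] v l = row_ops R [(h, k, b), (i, j, a)] v l"
    by (simp add: row_op_def algebra_simps)
qed

text \<open>The three commutator formulas below have the form \<open>x y = [x, y] y x\<close>, which avoids inverses.
  The first one concerns two short roots whose sum is short.\<close>

lemma row_op_short_short:
  assumes nz: "i \<noteq> 0" "j \<noteq> 0" "k \<noteq> 0"
    and ne: "\<bar>i\<bar> \<noteq> \<bar>j\<bar>" "\<bar>j\<bar> \<noteq> \<bar>k\<bar>" "\<bar>i\<bar> \<noteq> \<bar>k\<bar>"
  shows "row_ops R [(i, j, a), (j, k, b)] v = row_ops R [(i, k, a * b), (j, k, b), (i, j, a)] v"
proof (rule ext)
  fix l
  note simps = row_op_def algebra_simps dual_entry_mult[OF nz, symmetric]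
    distinct_index[OF ne(1)] distinct_index[OF ne(2)] distinct_index[OF ne(3)]
  consider "l = i" | "l = j" | "l = - j" | "l = - k" | "l \<notin> {i, j, - j, - k}" by auto
  then show "row_ops R [(i, j, a), (j, k, b)] v l
      = row_ops R [(i, k, a * b), (j, k, b), (i, j, a)] v l"
    using nz by cases (simp_all add: simps)
qed

text \<open>Two short roots whose sum is long: the parameter of the long transvection is a trace, which
  after rescaling lies in the smallest form parameter.\<close>

lemma row_op_short_short_long:
  assumes nz: "i \<noteq> 0" "j \<noteq> 0" and ne: "\<bar>i\<bar> \<noteq> \<bar>j\<bar>"
  shows "row_ops R [(i, j, a), (j, - i, b)] v
    = row_ops R [(i, - i, a * b - dual_entry R i (- i) (a * b)), (j, - i, b), (i, j, a)] v"
proof (rule ext)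
  fix l
  have mult: "dual_entry R i (- i) (a * b) = dual_entry R j (- i) b * dual_entry R i j a"
    using nz by (simp add: dual_entry_mult)
  note simps = row_op_def algebra_simps distinct_index[OF ne] nonzero_index[OF nz(1)]
    nonzero_index[OF nz(2)] mult
  consider "l = i" | "l = j" | "l = - j" | "l \<notin> {i, j, - j}" by auto
  then show "row_ops R [(i, j, a), (j, - i, b)] v l
      = row_ops R [(i, - i, a * b - dual_entry R i (- i) (a * b)), (j, - i, b), (i, j, a)] v l"
    using nz by cases (simp_all add: simps)
qed

text \<open>A short and a long root. The hypothesis on \<open>b\<close> is membership in the largest form parameter,
  transported to position \<open>(j, - j)\<close>; without it \<open>T i (- j) (a * b)\<close> would have the wrong dual
  entry.\<close>

lemma row_op_short_long:
  assumes nz: "i \<noteq> 0" "j \<noteq> 0" and ne: "\<bar>i\<bar> \<noteq> \<bar>j\<bar>" and b: "dual_entry R j (- j) b = - b"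
  shows "row_ops R [(i, j, a), (j, - j, b)] v
    = row_ops R [(i, - j, a * b), (i, - i, a * b * dual_entry R i j a), (j, - j, b), (i, j, a)] v"
proof (rule ext)
  fix l
  have mult: "dual_entry R i (- j) (a * b) = - b * dual_entry R i j a"
    using nz by (simp add: dual_entry_mult[of i j "- j", symmetric] b)
  note simps = row_op_def algebra_simps distinct_index[OF ne] nonzero_index[OF nz(1)]
    nonzero_index[OF nz(2)] mult
  consider "l = i" | "l = j" | "l = - j" | "l \<notin> {i, j, - j}" by auto
  then show "row_ops R [(i, j, a), (j, - j, b)] v l
      = row_ops R [(i, - j, a * b), (i, - i, a * b * dual_entry R i j a), (j, - j, b), (i, j, a)] v l"
    using nz by cases (simp_all add: simps)
qed

text \<open>The word on the left is the Weyl element exchanging \<open>i\<close> and \<open>p\<close>. For indices of equal sign no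
  power of \<open>lam R\<close> enters, and it is a signed permutation of the coordinates.\<close>

lemma row_op_weyl:
  assumes nz: "i \<noteq> 0" "p \<noteq> 0" and ne: "\<bar>i\<bar> \<noteq> \<bar>p\<bar>" and sgn: "sgn i = sgn p"
  shows "row_ops R [(p, i, 1), (i, p, - 1), (p, i, 1)] v =
     (\<lambda>k. if k = p then v i else if k = i then - v p
          else if k = - p then v (- i) else if k = - i then - v (- p) else v k)"
proof (rule ext)
  fix l
  have one: "dual_entry R i p 1 = 1" "dual_entry R p i 1 = 1"
    using nz sgn by (simp_all add: dual_entry_one)
  note simps = row_op_def algebra_simps distinct_index[OF ne] nonzero_index[OF nz(1)]
    nonzero_index[OF nz(2)] one
  consider "l = i" | "l = p" | "l = - i" | "l = - p" | "l \<notin> {i, p, - i, - p}" by auto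
  then show "row_ops R [(p, i, 1), (i, p, - 1), (p, i, 1)] v l =
      (if l = p then v i else if l = i then - v p
        else if l = - p then v (- i) else if l = - i then - v (- p) else v l)"
    using nz by cases (simp_all add: simps)
qed

text \<open>The signs of the permutation fall on \<open>p\<close> and \<open>- p\<close>, which are not touched by the
  transvections being moved, so the parameter \<open>a\<close> is unchanged.\<close>

lemma row_op_weyl_conj:
  assumes nz: "i \<noteq> 0" "p \<noteq> 0" "j \<noteq> 0" and ne: "\<bar>i\<bar> \<noteq> \<bar>p\<bar>" "\<bar>j\<bar> \<noteq> \<bar>p\<bar>"  "\<bar>j\<bar> \<noteq> \<bar>i\<bar>"
    and sgn: "sgn i = sgn p"
  shows "row_ops R [(p, i, 1), (i, p, - 1), (p, i, 1), (i, j, a)] v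
     = row_ops R [(p, j, a), (p, i, 1), (i, p, - 1), (p, i, 1)] v" (is ?ij)
  and "row_ops R [(p, i, 1), (i, p, - 1), (p, i, 1), (j, i, a)] v
     = row_ops R [(j, p, a), (p, i, 1), (i, p, - 1), (p, i, 1)] v" (is ?ji)
proof -
  have dual: "dual_entry R i j a = dual_entry R p j a" "dual_entry R j i a = dual_entry R j p a"
    using sgn by (simp_all add: dual_entry_def)
  note simps = row_op_def distinct_index[OF ne(1)] distinct_index[OF ne(2)]
    distinct_index[OF ne(3)] nonzero_index[OF nz(1)] nonzero_index[OF nz(2)]
    nonzero_index[OF nz(3)] dual
  have unfold: "row_ops R [(p, i, 1), (i, p, - 1), (p, i, 1), (k, l, a)] v
      = row_ops R [(p, i, 1), (i, p, - 1), (p, i, 1)] (row_op R k l a v)"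
    "row_ops R [(k, l, a), (p, i, 1), (i, p, - 1), (p, i, 1)] v
      = row_op R k l a (row_ops R [(p, i, 1), (i, p, - 1), (p, i, 1)] v)" for k l
    by simp_all
  show ?ij ?ji
    unfolding unfold row_op_weyl[OF nz(1,2) ne(1) sgn]
    using nz by (auto simp: simps fun_eq_iff)
qed

lemma row_op_weyl_conj_long:
  assumes nz: "i \<noteq> 0" "p \<noteq> 0" and ne: "\<bar>i\<bar> \<noteq> \<bar>p\<bar>" and sgn: "sgn i = sgn p"
  shows "row_ops R [(p, i, 1), (i, p, - 1), (p, i, 1), (i, - i, a)] v
     = row_ops R [(p, - p, a), (p, i, 1), (i, p, - 1), (p, i, 1)] v" (is ?pos)
  and "row_ops R [(p, i, 1), (i, p, - 1), (p, i, 1), (- i, i, a)] v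
     = row_ops R [(- p, p, a), (p, i, 1), (i, p, - 1), (p, i, 1)] v" (is ?neg)
proof -
  note simps = row_op_def distinct_index[OF ne] nonzero_index[OF nz(1)] nonzero_index[OF nz(2)]
  have unfold: "row_ops R [(p, i, 1), (i, p, - 1), (p, i, 1), (k, l, a)] v
      = row_ops R [(p, i, 1), (i, p, - 1), (p, i, 1)] (row_op R k l a v)"
    "row_ops R [(k, l, a), (p, i, 1), (i, p, - 1), (p, i, 1)] v
      = row_op R k l a (row_ops R [(p, i, 1), (i, p, - 1), (p, i, 1)] v)" for k l
    by simp_all
  show ?pos ?neg
    unfolding unfold row_op_weyl[OF nz ne sgn]
    using nz by (auto simp: simps fun_eq_iff)
qed

end

section \<open>Parameters of elementary transvections\<close>

lemma additive_subgrpD: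
  assumes "additive_subgrp S"
  shows "0 \<in> S" "x \<in> S \<Longrightarrow> - x \<in> S" "x \<in> S \<Longrightarrow> y \<in> S \<Longrightarrow> x + y \<in> S"
proof -
  show 0: "0 \<in> S" using assms by (simp add: additive_subgrp_def)
  show m: "- x \<in> S" if "x \<in> S" for x
    using assms 0 that unfolding additive_subgrp_def by (metis diff_0)
  show "x + y \<in> S" if "x \<in> S" "y \<in> S" for x y
    using assms m[OF that(2)] that(1) unfolding additive_subgrp_def
    by (metis diff_minus_eq_add)
qed

lemma group_closure_subset:
  assumes "additive_subgrp S" "B \<subseteq> S"
  shows "group_closure B \<subseteq> S"
proof
  fix x assume "x \<in> group_closure B"
  then show "x \<in> S"
    by induction (use assms in \<open>auto simp: additive_subgrp_def\<close>)
qed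

text \<open>The parameters at a long position \<open>(i, - i)\<close> form a scaled copy of the form parameter. This is
  the scaling factor that carries them back, see \<open>component_long\<close> below.\<close>

definition long_scale :: "('a::{ring, monoid_mult}) form_data \<Rightarrow> int \<Rightarrow> 'a" where
  "long_scale R i = (if 0 < i then lam R else 1)"

context form_ring
begin

lemma component_long:
  assumes "i \<noteq> 0"
  shows "a \<in> component R (I, \<Gamma>) i (- i) \<longleftrightarrow> long_scale R i * a \<in> \<Gamma>"
proof (cases "0 < i")
  case True
  then have "a \<in> component R (I, \<Gamma>) i (- i) \<longleftrightarrow> (\<exists>x\<in>\<Gamma>. a = bar R (lam R) * x)"
    by (auto simp: lam_pow_def sgn_if)
  also have "\<dots> \<longleftrightarrow> lam R * a \<in> \<Gamma>"
    by (metis lam_cancel)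
  finally show ?thesis using True by (simp add: long_scale_def)
qed (use assms in \<open>auto simp: lam_pow_def sgn_if long_scale_def\<close>)

lemma component_short: "j \<noteq> - i \<Longrightarrow> component R (I, \<Gamma>) i j = I"
  by simp

text \<open>The long parameter in the short-long commutator formula becomes \<open>b \<gamma> bar b\<close> after rescaling,
  which is the shape in which conjugation occurs in the definition of form ideals and of the
  symmetrised product.\<close>

lemma long_scale_conj:
  assumes "i \<noteq> 0" "j \<noteq> 0"
  shows "long_scale R i * (b * a * dual_entry R i j b) = b * (long_scale R j * a) * bar R b"
  using assms
  by (simp add: dual_entry_cases long_scale_def mult.assoc lam_left_commute[of b] lam_left_commute[of a])

text \<open>The same for the trace in the formula for two short roots: it becomes a generator
  \<open>y - lam R * bar R y\<close> of the smallest form parameter.\<close>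

lemma long_scale_trace:
  assumes "i \<noteq> 0"
  shows "long_scale R i * (x - dual_entry R i (- i) x)
    = long_scale R i * x - lam R * bar R (long_scale R i * x)"
  using assms
  by (simp add: dual_entry_cases long_scale_def bar_mult right_diff_distrib
      bar_lam_central[symmetric])

lemma dual_entry_long:
  assumes "i \<noteq> 0" and a: "a \<in> component R (UNIV, Lam R) i (- i)"
  shows "dual_entry R i (- i) a = - a"
proof -
  let ?x = "long_scale R i * a"
  have "?x = - (lam R * bar R ?x)"
    using a assms(1) Lam_le_max unfolding component_long[OF assms(1)] Lam_max_def by auto
  also have "lam R * bar R ?x = long_scale R i * dual_entry R i (- i) a"
    using long_scale_trace[OF assms(1), of a] by (simp add: right_diff_distrib)
  finally have "long_scale R i * a = long_scale R i * (- dual_entry R i (- i) a)" by simp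
  then have "a = - dual_entry R i (- i) a"
    unfolding long_scale_def by (metis lam_cancel(2) mult_1_left)
  then show ?thesis by (metis minus_minus)
qed

lemma form_idealD:
  assumes "form_ideal R (I, \<Gamma>)"
  shows "additive_subgrp I" "additive_subgrp \<Gamma>" "\<And>c a. a \<in> I \<Longrightarrow> c * a \<in> I"
    "\<And>c a. a \<in> I \<Longrightarrow> a * c \<in> I" "\<And>a. a \<in> I \<Longrightarrow> bar R a \<in> I"
    "\<And>a. a \<in> I \<Longrightarrow> a - lam R * bar R a \<in> \<Gamma>"
    "\<Gamma> \<subseteq> I" "\<Gamma> \<subseteq> Lam R" "\<And>c x. x \<in> \<Gamma> \<Longrightarrow> c * x * bar R c \<in> \<Gamma>"
proof -
  have *: "two_sided_ideal I" "bar R ` I = I" "additive_subgrp \<Gamma>" "Gam_min R I \<subseteq> \<Gamma>"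
    "\<Gamma> \<subseteq> Gam_max R I" "\<And>c x. x \<in> \<Gamma> \<Longrightarrow> c * x * bar R c \<in> \<Gamma>"
    using assms by auto
  show "additive_subgrp I" "\<And>c a. a \<in> I \<Longrightarrow> c * a \<in> I" "\<And>c a. a \<in> I \<Longrightarrow> a * c \<in> I"
    using *(1) unfolding two_sided_ideal_def by blast+
  show "additive_subgrp \<Gamma>" "\<And>c x. x \<in> \<Gamma> \<Longrightarrow> c * x * bar R c \<in> \<Gamma>" by (fact *)+
  show "\<And>a. a \<in> I \<Longrightarrow> bar R a \<in> I" using *(2) by blast
  show "\<Gamma> \<subseteq> I" "\<Gamma> \<subseteq> Lam R" using *(5) by (auto simp: Gam_max_def)
  show "a - lam R * bar R a \<in> \<Gamma>" if "a \<in> I" for a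
  proof -
    have "a - lam R * bar R a + 0 \<in> Gam_min R I"
      unfolding Gam_min_def by (rule set_plus_intro) (use that in auto)
    then show ?thesis using *(4) by auto
  qed
qed

lemma Gam_min_Lam: "Gam_min R S \<subseteq> Lam R"
proof -
  have "x + y \<in> Lam R" if "x \<in> {a - lam R * bar R a | a. a \<in> S}"
    "y \<in> group_closure {a * c * bar R a | a c. a \<in> S \<and> c \<in> Lam R}" for x y
  proof (rule additive_subgrpD(3)[OF Lam_subgrp])
    show "x \<in> Lam R" using that(1) Lam_min_le unfolding Lam_min_def by auto
    show "y \<in> Lam R"
      using that(2) group_closure_subset[OF Lam_subgrp, of "{a * c * bar R a | a c. a \<in> S \<and> c \<in> Lam R}"]
        Lam_conj by auto
  qed
  then show ?thesis
    unfolding Gam_min_def set_plus_def by blast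
qed

text \<open>The absolute case is the form ideal \<open>(UNIV, Lam R)\<close>, so statements on form ideals
  apply to the elementary group itself.\<close>

lemma form_ideal_UNIV: "form_ideal R (UNIV, Lam R)"
proof -
  have "Gam_min R UNIV \<subseteq> Lam R" by (rule Gam_min_Lam)
  moreover have "bar R ` UNIV = UNIV"
    by (metis bar_bar surjI)
  ultimately show ?thesis
    using Lam_subgrp Lam_conj
    by (simp add: two_sided_ideal_def additive_subgrp_def Gam_max_def)
qed

lemma dual_entry_in_ideal:
  assumes "form_ideal R (I, \<Gamma>)" "a \<in> I"
  shows "- dual_entry R i j a \<in> I"
  unfolding dual_entry_def using assms form_idealD[OF assms(1)] additive_subgrpD by metis

lemma component_long_subset:
  assumes "form_ideal R (I, \<Gamma>)" "i \<noteq> 0" "a \<in> component R (I, \<Gamma>) i (- i)"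
  shows "a \<in> I"
proof -
  have "long_scale R i * a \<in> I"
    using assms form_idealD[OF assms(1)] by (auto simp: component_long simp del: component.simps)
  then have "bar R (lam R) * (long_scale R i * a) \<in> I" "long_scale R i * a \<in> I"
    using form_idealD(3)[OF assms(1)] by auto
  then show ?thesis by (auto simp: long_scale_def split: if_splits)
qed

lemma component_long_conj:
  assumes "form_ideal R (I, \<Gamma>)" "i \<noteq> 0" "j \<noteq> 0" "a \<in> component R (I, \<Gamma>) j (- j)"
  shows "b * a * dual_entry R i j b \<in> component R (I, \<Gamma>) i (- i)"
  using assms form_idealD(9)[OF assms(1)]
  by (simp add: component_long long_scale_conj del: component.simps)

lemma component_subset_UNIV:
  assumes "\<Gamma> \<subseteq> Lam R" "i \<noteq> 0"
  shows "component R (I, \<Gamma>) i j \<subseteq> component R (UNIV, Lam R) i j"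
  using assms by (cases "j = - i") auto

subsection \<open>The symmetrised product\<close>

lemma sym_prod_commute: "sym_prod R (I, \<Gamma>) (J, \<Delta>) = sym_prod R (J, \<Delta>) (I, \<Gamma>)"
  by (simp add: add.commute add.left_commute add.assoc)

lemma ideal_mult_incl: "a \<in> I \<Longrightarrow> b \<in> J \<Longrightarrow> a * b \<in> ideal_mult I J"
  unfolding ideal_mult_def by (rule group_closure.base) blast

text \<open>The next three lemmas say that the parameters produced by the three commutator formulas, with one
  argument from each form ideal, lie in the symmetrised product.\<close>

lemma sym_prod_short:
  assumes "a \<in> I" "b \<in> J" "j \<noteq> - i"
  shows "a * b \<in> component R (sym_prod R (I, \<Gamma>) (J, \<Delta>)) i j"
proof -
  have "a * b + 0 \<in> ideal_mult I J + ideal_mult J I"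
    by (rule set_plus_intro[OF ideal_mult_incl[OF assms(1,2)]]) (simp add: ideal_mult_def)
  then show ?thesis using assms by simp
qed

lemma sym_prod_trace:
  assumes "form_ideal R (I, \<Gamma>)" "a \<in> I" "b \<in> J" "i \<noteq> 0"
  shows "a * b - dual_entry R i (- i) (a * b) \<in> component R (sym_prod R (I, \<Gamma>) (J, \<Delta>)) i (- i)"
proof -
  have "(long_scale R i * a) * b + 0 \<in> ideal_mult I J + ideal_mult J I"
    by (intro set_plus_intro ideal_mult_incl form_idealD(3)[OF assms(1)] assms) (simp add: ideal_mult_def)
  then have y: "long_scale R i * (a * b) \<in> ideal_mult I J + ideal_mult J I"
    by (simp add: mult.assoc)
  have "long_scale R i * (a * b) - lam R * bar R (long_scale R i * (a * b)) + 0
    \<in> Gam_min R (ideal_mult I J + ideal_mult J I)"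
    unfolding Gam_min_def by (rule set_plus_intro) (use y in auto)
  then have "long_scale R i * (a * b) - lam R * bar R (long_scale R i * (a * b)) + 0 + 0 + 0
    \<in> Gam_min R (ideal_mult I J + ideal_mult J I) + conj_span R J \<Gamma> + conj_span R I \<Delta>"
    by (intro set_plus_intro) (auto simp: conj_span_def)
  then show ?thesis
    using assms(4) by (simp add: component_long long_scale_trace del: component.simps)
qed

lemma zero_in_Gam_min: "0 \<in> S \<Longrightarrow> 0 \<in> Gam_min R S"
proof -
  assume "0 \<in> S"
  then have "0 - lam R * bar R 0 \<in> {a - lam R * bar R a | a. a \<in> S}" by blast
  then have "(0 - lam R * bar R 0) + 0 \<in> Gam_min R S"
    unfolding Gam_min_def by (rule set_plus_intro) simp
  then show ?thesis by simp
qed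

lemma sym_prod_conj:
  assumes "a \<in> I" "x \<in> component R (J, \<Delta>) j (- j)" "i \<noteq> 0" "j \<noteq> 0"
  shows "a * x * dual_entry R i j a \<in> component R (sym_prod R (I, \<Gamma>) (J, \<Delta>)) i (- i)"
proof -
  have "long_scale R j * x \<in> \<Delta>"
    using assms by (simp add: component_long del: component.simps)
  then have "a * (long_scale R j * x) * bar R a \<in> conj_span R I \<Delta>"
    unfolding conj_span_def using assms(1) by (intro group_closure.base) blast
  moreover have "0 + 0 \<in> ideal_mult I J + ideal_mult J I"
    by (rule set_plus_intro) (simp_all add: ideal_mult_def)
  ultimately have "0 + 0 + a * (long_scale R j * x) * bar R a
    \<in> Gam_min R (ideal_mult I J + ideal_mult J I) + conj_span R J \<Gamma> + conj_span R I \<Delta>"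
    by (intro set_plus_intro zero_in_Gam_min) (auto simp: conj_span_def)
  then show ?thesis
    using assms by (simp add: component_long long_scale_conj del: component.simps)
qed

lemma sym_prod_Lam:
  assumes "form_ideal R (I, \<Gamma>)" "form_ideal R (J, \<Delta>)"
  shows "snd (sym_prod R (I, \<Gamma>) (J, \<Delta>)) \<subseteq> Lam R"
proof -
  note plus = additive_subgrpD(3)[OF Lam_subgrp]
  have conj: "conj_span R S \<Theta> \<subseteq> Lam R" if "\<Theta> \<subseteq> Lam R" for S \<Theta>
    unfolding conj_span_def using that Lam_conj by (intro group_closure_subset[OF Lam_subgrp]) auto
  show ?thesis
  proof
    fix z assume "z \<in> snd (sym_prod R (I, \<Gamma>) (J, \<Delta>))"
    then obtain p q r where "z = p + q + r" "p \<in> Gam_min R (ideal_mult I J + ideal_mult J I)"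
      "q \<in> conj_span R J \<Gamma>" "r \<in> conj_span R I \<Delta>"
      by (auto elim!: set_plus_elim)
    moreover have "conj_span R J \<Gamma> \<subseteq> Lam R" "conj_span R I \<Delta> \<subseteq> Lam R"
      using conj form_idealD(8) assms by blast+
    ultimately show "z \<in> Lam R"
      using plus Gam_min_Lam by (metis subsetD)
  qed
qed

end

section \<open>Generated subgroups and commutators\<close>

lemma group_hom_generate_subset:
  assumes "group_hom G H h" "A \<subseteq> carrier G" "h ` A \<subseteq> K" "subgroup K H"
  shows "h ` generate G A \<subseteq> K"
proof -
  interpret group_hom G H h by fact
  show ?thesis
    using generate_img[OF assms(2)] H.generate_subgroup_incl[OF assms(3,4)] by simp
qed

definition (in monoid) commutator :: "'a \<Rightarrow> 'a \<Rightarrow> 'a" where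
  "commutator x y = x \<otimes> y \<otimes> inv x \<otimes> inv y"

context group
begin

lemma commutator_closed [simp]:
  "x \<in> carrier G \<Longrightarrow> y \<in> carrier G \<Longrightarrow> commutator x y \<in> carrier G"
  by (simp add: commutator_def)

lemma commutator_eq_one_iff:
  assumes "x \<in> carrier G" "y \<in> carrier G"
  shows "commutator x y = \<one> \<longleftrightarrow> x \<otimes> y = y \<otimes> x"
proof -
  have "commutator x y = (x \<otimes> y) \<otimes> inv (y \<otimes> x)"
    using assms by (simp add: commutator_def inv_mult_group m_assoc)
  then show ?thesis
    using assms by (metis inv_solve_right' l_one m_closed one_closed r_inv)
qed

lemma inv_commutator:
  assumes "x \<in> carrier G" "y \<in> carrier G"
  shows "inv (commutator x y) = commutator y x"
  using assms by (simp add: commutator_def inv_mult_group m_assoc)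

lemma conj_commutator:
  assumes "w \<in> carrier G" "x \<in> carrier G" "y \<in> carrier G" "x' \<in> carrier G" "y' \<in> carrier G"
    and "w \<otimes> x = x' \<otimes> w" "w \<otimes> y = y' \<otimes> w"
  shows "w \<otimes> commutator x y = commutator x' y' \<otimes> w"
proof -
  have inv: "w \<otimes> inv a = inv b \<otimes> w" if "a \<in> carrier G" "b \<in> carrier G" "w \<otimes> a = b \<otimes> w" for a b
  proof -
    have "inv b \<otimes> w = inv b \<otimes> (w \<otimes> a) \<otimes> inv a"
      using that(1,2) assms(1) by (simp add: m_assoc)
    also have "\<dots> = inv b \<otimes> (b \<otimes> w) \<otimes> inv a" using that(3) by simp
    also have "\<dots> = w \<otimes> inv a" using that(1,2) assms(1) by (simp flip: m_assoc)
    finally show ?thesis by simp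
  qed
  have "w \<otimes> (x \<otimes> y \<otimes> inv x \<otimes> inv y) = x' \<otimes> w \<otimes> y \<otimes> inv x \<otimes> inv y"
    using assms by (simp flip: m_assoc)
  also have "\<dots> = x' \<otimes> y' \<otimes> w \<otimes> inv x \<otimes> inv y"
    using assms by (simp add: m_assoc)
  also have "\<dots> = x' \<otimes> y' \<otimes> inv x' \<otimes> w \<otimes> inv y"
    using assms inv[of x x'] by (simp add: m_assoc)
  also have "\<dots> = x' \<otimes> y' \<otimes> inv x' \<otimes> inv y' \<otimes> w"
    using assms inv[of y y'] by (simp add: m_assoc)
  finally show ?thesis by (simp add: commutator_def)
qed

lemma commute_inv:
  assumes "x \<in> carrier G" "y \<in> carrier G" "x \<otimes> y = y \<otimes> x"
  shows "x \<otimes> inv y = inv y \<otimes> x"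
  using assms by (metis inv_closed inv_solve_left inv_solve_right m_assoc m_closed)

lemma subgroup_centralizer:
  assumes "x \<in> carrier G"
  shows "subgroup {y \<in> carrier G. x \<otimes> y = y \<otimes> x} G"
proof (rule subgroupI)
  show "{y \<in> carrier G. x \<otimes> y = y \<otimes> x} \<noteq> {}"
    using assms by (auto intro: exI[of _ \<one>])
next
  fix a b assume "a \<in> {y \<in> carrier G. x \<otimes> y = y \<otimes> x}" "b \<in> {y \<in> carrier G. x \<otimes> y = y \<otimes> x}"
  then have "a \<in> carrier G" "b \<in> carrier G" "x \<otimes> a = a \<otimes> x" "x \<otimes> b = b \<otimes> x" by auto
  then show "a \<otimes> b \<in> {y \<in> carrier G. x \<otimes> y = y \<otimes> x}"
    using assms by (simp flip: m_assoc) (simp add: m_assoc)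
qed (use assms commute_inv in auto)

text \<open>The mechanism behind centrality: \<open>z\<close> conjugates \<open>x\<close> to \<open>u x\<close> and fixes \<open>y\<close>, and the extra
  factor \<open>u\<close> drops out of \<open>[u x, y]\<close> because it commutes with \<open>x\<close> and with \<open>y\<close>.\<close>

lemma commute_commutator:
  assumes xy: "x \<in> carrier G" "y \<in> carrier G" and z: "z \<in> carrier G" and u: "u \<in> carrier G"
    and zx: "z \<otimes> x = u \<otimes> x \<otimes> z" and zy: "z \<otimes> y = y \<otimes> z"
    and ux: "u \<otimes> x = x \<otimes> u" and uy: "u \<otimes> y = y \<otimes> u"
  shows "commutator x y \<otimes> z = z \<otimes> commutator x y"
proof -
  have "z \<otimes> commutator x y = commutator (u \<otimes> x) y \<otimes> z"
    by (rule conj_commutator) (use assms in auto)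
  also have "commutator (u \<otimes> x) y = commutator x y"
  proof -
    have "commutator (u \<otimes> x) y = u \<otimes> (x \<otimes> y \<otimes> inv x) \<otimes> (inv u \<otimes> inv y)"
      using xy u by (simp add: commutator_def inv_mult_group m_assoc)
    also have "u \<otimes> (x \<otimes> y \<otimes> inv x) = (x \<otimes> y \<otimes> inv x) \<otimes> u"
      using xy u ux uy commute_inv[OF u xy(1) ux] subgroup_centralizer[OF u]
      by (auto simp: subgroup_def)
    finally show ?thesis
      using xy u by (simp add: commutator_def m_assoc flip: m_assoc[of u "inv u"])
  qed
  finally show ?thesis by simp
qed

text \<open>Since \<open>[a b, c] = a [b, c] inv a [a, c]\<close>, and the conjugation by \<open>a\<close> has no effect on a subgroup that
  is centralised by \<open>a\<close>, commutation is multiplicative in each argument. Hence it is enough to know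
  the commutators of generators.\<close>

lemma commutators_in_central_subgroup:
  assumes H: "subgroup H G" and A: "A \<subseteq> carrier G" and B: "B \<subseteq> carrier G"
    and gens: "\<And>s t. s \<in> A \<Longrightarrow> t \<in> B \<Longrightarrow> commutator s t \<in> H"
    and central: "\<And>h x. h \<in> H \<Longrightarrow> x \<in> generate G A \<union> generate G B \<Longrightarrow> h \<otimes> x = x \<otimes> h"
    and x: "x \<in> generate G A" and y: "y \<in> generate G B"
  shows "commutator x y \<in> H"
proof -
  have left: "commutator a b \<in> H"
    if K: "K \<subseteq> carrier G" and a: "a \<in> generate G K" and b: "b \<in> carrier G"
      and cen: "\<And>h x. h \<in> H \<Longrightarrow> x \<in> generate G K \<Longrightarrow> h \<otimes> x = x \<otimes> h"
      and base: "\<And>k. k \<in> K \<Longrightarrow> commutator k b \<in> H" for K a b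
    using a
  proof induction
    case one
    then show ?case using H b by (simp add: commutator_def subgroup.one_closed)
  next
    case (incl k)
    then show ?case by (rule base)
  next
    case (inv k)
    then have k: "k \<in> carrier G" using K by auto
    let ?c = "inv (commutator k b)"
    have c: "?c \<in> H" using base[OF inv] H by (simp add: subgroup.m_inv_closed)
    then have "inv k \<otimes> ?c = ?c \<otimes> inv k" using cen generate.inv[OF inv] by metis
    moreover have "commutator (inv k) b = inv k \<otimes> ?c \<otimes> k"
      using k b by (simp add: inv_commutator) (simp add: commutator_def m_assoc)
    ultimately have "commutator (inv k) b = ?c"
      using k b by (simp add: m_assoc)
    then show ?case using c by simp
  next
    case (eng h1 h2)
    have h: "h1 \<in> carrier G" "h2 \<in> carrier G" using eng generate_in_carrier[OF K] by auto
    have "commutator (h1 \<otimes> h2) b = h1 \<otimes> commutator h2 b \<otimes> (b \<otimes> inv h1 \<otimes> inv b)"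
      using h b by (simp add: commutator_def inv_mult_group m_assoc)
        (simp add: m_assoc[symmetric])
    also have "h1 \<otimes> commutator h2 b = commutator h2 b \<otimes> h1"
      using cen eng by metis
    also have "commutator h2 b \<otimes> h1 \<otimes> (b \<otimes> inv h1 \<otimes> inv b) = commutator h2 b \<otimes> commutator h1 b"
      using h b by (simp add: commutator_def m_assoc)
    finally show ?case using eng H by (simp add: subgroup.m_closed)
  qed
  have xy: "x \<in> carrier G" "y \<in> carrier G"
    using x y generate_in_carrier A B by auto
  have "commutator s y \<in> H" if s: "s \<in> A" for s
  proof -
    have sc: "s \<in> carrier G" using s A by auto
    have "commutator t s \<in> H" if "t \<in> B" for t
    proof -
      have "inv (commutator s t) \<in> H" using gens[OF s that] H by (simp add: subgroup.m_inv_closed)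
      then show ?thesis using that B sc by (simp add: inv_commutator subsetD)
    qed
    then have "commutator y s \<in> H"
      using central by (intro left[OF B y sc]) auto
    then have "inv (commutator y s) \<in> H" using H by (simp add: subgroup.m_inv_closed)
    then show ?thesis using sc xy by (simp add: inv_commutator)
  qed
  then show ?thesis
    using central by (intro left[OF A x xy(2)]) auto
qed

end

section \<open>Elementary subgroups\<close>

text \<open>The generators of an elementary subgroup, given by position and parameter. Working with the
  triples instead of the matrices lets the same index set describe images in a quotient.\<close>

definition elem_params ::
  "('a::{ring, monoid_mult}) form_data \<Rightarrow> nat \<Rightarrow> 'a set \<times> 'a set \<Rightarrow> (int \<times> int \<times> 'a) set" where
  "elem_params R n X = {(i, j, a). i \<in> Om n \<and> j \<in> Om n \<and> i \<noteq> j \<and> a \<in> component R X i j}"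

lemma elem_params_iff [simp]:
  "(i, j, a) \<in> elem_params R n X
    \<longleftrightarrow> i \<in> Om n \<and> j \<in> Om n \<and> i \<noteq> j \<and> a \<in> component R X i j"
  by (simp add: elem_params_def)

lemma FU_eq: "FU R n X = generate (GL n) ((\<lambda>(i, j, a). T R n i j a) ` elem_params R n X)"
proof -
  have "{T R n i j a | i j a. (i, j, a) \<in> elem_params R n X}
    = (\<lambda>(i, j, a). T R n i j a) ` elem_params R n X"
    unfolding set_eq_iff image_iff Bex_def split_paired_Ex by auto
  then show ?thesis by (simp add: FU_def)
qed

context form_ring
begin

lemma T_in_GL:
  assumes "i \<in> Om n" "j \<in> Om n" "i \<noteq> j"
  shows "T R n i j c \<in> carrier (GL n)"
proof -
  have nz: "i \<noteq> 0" "j \<noteq> 0" using assms by (auto simp: Om_iff)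
  have inv: "T R n i j c \<otimes>\<^bsub>mat_monoid n\<^esub> T R n i j (- c) = \<one>\<^bsub>mat_monoid n\<^esub>" for c
  proof -
    have "T_prod R n [(i, j, c), (i, j, - c)] = T_prod R n []"
      by (rule T_prod_eqI) (use assms row_op_sum[OF nz assms(3), of c "- c"] row_op_zero in auto)
    then show ?thesis
      using assms by (simp add: monoid.r_one[OF monoid_mat_monoid] T_in_mat_monoid)
  qed
  show ?thesis
    unfolding GL_def units_of_carrier Units_def
    using inv[of c] inv[of "- c"] T_in_mat_monoid[OF assms(1,2)] by auto
qed

lemma elem_gens_in_GL: "(\<lambda>(i, j, a). T R n i j a) ` elem_params R n X \<subseteq> carrier (GL n)"
  using T_in_GL by auto

lemma subgroup_FU: "subgroup (FU R n X) (GL n)"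
  unfolding FU_eq by (rule group.generate_is_subgroup[OF group_GL elem_gens_in_GL])

lemma subgroup_EU_abs: "subgroup (EU_abs R n) (GL n)"
  unfolding EU_abs_def by (rule subgroup_FU)

lemma elem_params_subset:
  assumes "snd X \<subseteq> Lam R"
  shows "elem_params R n X \<subseteq> elem_params R n (UNIV, Lam R)"
proof
  fix x assume "x \<in> elem_params R n X"
  then show "x \<in> elem_params R n (UNIV, Lam R)"
    using component_subset_UNIV[OF assms, of _ "fst X"]
    by (cases x) (auto simp: Om_iff simp del: component.simps)
qed

lemma FU_subset_EU_abs: "snd X \<subseteq> Lam R \<Longrightarrow> FU R n X \<subseteq> EU_abs R n"
  unfolding EU_abs_def FU_eq
  by (intro group.mono_generate[OF group_GL] image_mono elem_params_subset)

lemma T_in_EU_abs: "(i, j, c) \<in> elem_params R n (UNIV, Lam R) \<Longrightarrow> T R n i j c \<in> EU_abs R n"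
  unfolding EU_abs_def FU_eq
  by (rule generate.incl, rule image_eqI[of _ _ "(i, j, c)"]) auto

lemma component_sgn_cong:
  "sgn i = sgn p \<Longrightarrow> component R X i (- i) = component R X p (- p)"
  by (cases X) simp

end

section \<open>Homomorphic images of the elementary group\<close>

text \<open>The argument runs in a quotient of the elementary group. Any homomorphism \<open>\<phi>\<close> into a
  group \<open>Q\<close> will do: the relations between transvections carry over to their images \<open>t\<close>.\<close>

locale elementary_hom = form_ring R + Q: group Q
  for R :: "('a::{ring, monoid_mult}) form_data" and Q :: "('q, 'r) monoid_scheme" (structure) +
  fixes m :: nat and \<phi> :: "'a imat \<Rightarrow> 'q"
  assumes hom: "\<phi> \<in> hom ((GL m)\<lparr>carrier := EU_abs R m\<rparr>) Q"
begin

definition t :: "int \<Rightarrow> int \<Rightarrow> 'a \<Rightarrow> 'q" where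
  "t i j c = \<phi> (T R m i j c)"

abbreviation full :: "(int \<times> int \<times> 'a) set" where
  "full \<equiv> elem_params R m (UNIV, Lam R)"

sublocale \<phi>: group_hom "(GL m)\<lparr>carrier := EU_abs R m\<rparr>" Q \<phi>
  by (intro group_hom.intro group_hom_axioms.intro Q.group_axioms hom
      group.subgroup_imp_group[OF group_GL subgroup_EU_abs])

lemma t_closed: "(i, j, c) \<in> full \<Longrightarrow> t i j c \<in> carrier Q"
  unfolding t_def using \<phi>.hom_closed T_in_EU_abs by simp

lemma \<phi>_T_prod:
  "set ts \<subseteq> full \<Longrightarrow> T_prod R m ts \<in> EU_abs R m
    \<and> \<phi> (T_prod R m ts) = foldr (\<lambda>(i, j, c) g. t i j c \<otimes> g) ts \<one>"
proof (induction ts)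
  case Nil
  then show ?case
    using \<phi>.hom_one subgroup.one_closed[OF subgroup_EU_abs, of m] by (simp add: one_GL)
next
  case (Cons x ts)
  obtain i j c where x: "x = (i, j, c)" by (cases x)
  have T: "T R m i j c \<in> EU_abs R m" using Cons.prems x by (intro T_in_EU_abs) auto
  have IH: "T_prod R m ts \<in> EU_abs R m"
    "\<phi> (T_prod R m ts) = foldr (\<lambda>(i, j, c) g. t i j c \<otimes> g) ts \<one>"
    using Cons by auto
  show ?case
    using \<phi>.hom_mult[of "T R m i j c" "T_prod R m ts"] subgroup.m_closed[OF subgroup_EU_abs T IH(1)]
      T IH by (simp add: x mult_GL t_def)
qed

lemma t_relation:
  assumes "set ts \<subseteq> full" "set us \<subseteq> full" "\<And>v. row_ops R ts v = row_ops R us v"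
  shows "foldr (\<lambda>(i, j, c) g. t i j c \<otimes> g) ts \<one> = foldr (\<lambda>(i, j, c) g. t i j c \<otimes> g) us \<one>"
proof -
  have "T_prod R m ts = T_prod R m us"
    by (rule T_prod_eqI) (use assms in auto)
  then show ?thesis
    using \<phi>_T_prod[OF assms(1)] \<phi>_T_prod[OF assms(2)] by simp
qed

lemma t_dual:
  assumes "i \<in> Om m" "j \<in> Om m" "\<bar>i\<bar> \<noteq> \<bar>j\<bar>"
  shows "t i j c = t (- j) (- i) (- dual_entry R i j c)"
proof -
  have full: "(i, j, c) \<in> full" "(- j, - i, - dual_entry R i j c) \<in> full" using assms by auto
  have "t (- j) (- i) (- dual_entry R i j c) \<otimes> \<one> = t i j c \<otimes> \<one>"
    using t_relation[of "[(- j, - i, - dual_entry R i j c)]" "[(i, j, c)]"] full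
      row_op_dual[of i j c] assms by (auto simp: Om_iff)
  then show ?thesis using full by (simp add: t_closed del: elem_params_iff)
qed

lemma t_commute:
  assumes "(i, j, a) \<in> full" "(h, k, b) \<in> full" "j \<noteq> h" "j \<noteq> - k" "i \<noteq> k" "i \<noteq> - h"
  shows "t i j a \<otimes> t h k b = t h k b \<otimes> t i j a"
  using t_relation[of "[(i, j, a), (h, k, b)]" "[(h, k, b), (i, j, a)]"] assms
    row_op_commute[OF assms(3-6)] by (simp add: t_closed del: elem_params_iff)

lemma t_short_short:
  assumes "i \<in> Om m" "j \<in> Om m" "k \<in> Om m" "\<bar>i\<bar> \<noteq> \<bar>j\<bar>" "\<bar>j\<bar> \<noteq> \<bar>k\<bar>" "\<bar>i\<bar> \<noteq> \<bar>k\<bar>"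
  shows "t i j a \<otimes> t j k b = t i k (a * b) \<otimes> t j k b \<otimes> t i j a"
proof -
  have full: "(i, j, a) \<in> full" "(j, k, b) \<in> full" "(i, k, a * b) \<in> full" using assms by auto
  show ?thesis
    using t_relation[of "[(i, j, a), (j, k, b)]" "[(i, k, a * b), (j, k, b), (i, j, a)]"] full
      row_op_short_short[OF assms(1-3)[THEN Om_nonzero] assms(4-6)]
    by (simp add: t_closed Q.m_assoc del: elem_params_iff)
qed

lemma trace_in_component:
  "i \<noteq> 0 \<Longrightarrow> c - dual_entry R i (- i) c \<in> component R (UNIV, Lam R) i (- i)"
  using form_idealD(6)[OF form_ideal_UNIV]
  by (simp add: component_long long_scale_trace del: component.simps)

lemma t_short_short_long:
  assumes "i \<in> Om m" "j \<in> Om m" "\<bar>i\<bar> \<noteq> \<bar>j\<bar>"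
  shows "t i j a \<otimes> t j (- i) b
    = t i (- i) (a * b - dual_entry R i (- i) (a * b)) \<otimes> t j (- i) b \<otimes> t i j a"
proof -
  let ?c = "a * b - dual_entry R i (- i) (a * b)"
  have full: "(i, j, a) \<in> full" "(j, - i, b) \<in> full" "(i, - i, ?c) \<in> full"
    using assms trace_in_component[of i "a * b"] by (auto simp: Om_iff simp del: component.simps) auto
  show ?thesis
    using t_relation[of "[(i, j, a), (j, - i, b)]" "[(i, - i, ?c), (j, - i, b), (i, j, a)]"] full
      row_op_short_short_long[OF assms(1,2)[THEN Om_nonzero] assms(3)]
    by (simp add: t_closed Q.m_assoc del: elem_params_iff)
qed

lemma t_short_long:
  assumes "i \<in> Om m" "j \<in> Om m" "\<bar>i\<bar> \<noteq> \<bar>j\<bar>" and b: "b \<in> component R (UNIV, Lam R) j (- j)"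
  shows "t i j a \<otimes> t j (- j) b
    = t i (- j) (a * b) \<otimes> t i (- i) (a * b * dual_entry R i j a) \<otimes> t j (- j) b \<otimes> t i j a"
proof -
  let ?c = "a * b * dual_entry R i j a"
  have nz: "i \<noteq> 0" "j \<noteq> 0" using assms by (auto simp: Om_iff)
  have c: "?c \<in> component R (UNIV, Lam R) i (- i)"
    by (rule component_long_conj[OF form_ideal_UNIV nz b])
  have full: "(i, j, a) \<in> full" "(j, - j, b) \<in> full" "(i, - j, a * b) \<in> full" "(i, - i, ?c) \<in> full"
    using assms c nz by (auto simp del: component.simps) (auto simp: component_short)
  show ?thesis
    using t_relation[of "[(i, j, a), (j, - j, b)]"
        "[(i, - j, a * b), (i, - i, ?c), (j, - j, b), (i, j, a)]"] full
      row_op_short_long[OF nz assms(3) dual_entry_long[OF nz(2) b]]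
    by (simp add: t_closed Q.m_assoc del: elem_params_iff)
qed

definition weyl :: "int \<Rightarrow> int \<Rightarrow> 'q" where
  "weyl p i = t p i 1 \<otimes> t i p (- 1) \<otimes> t p i 1"

lemma weyl_closed:
  assumes "i \<in> Om m" "p \<in> Om m" "\<bar>i\<bar> \<noteq> \<bar>p\<bar>"
  shows "weyl p i \<in> carrier Q"
proof -
  have "(p, i, 1) \<in> full" "(i, p, - 1) \<in> full" using assms by auto
  then show ?thesis by (simp add: weyl_def t_closed del: elem_params_iff)
qed

lemma weyl_conj:
  assumes "i \<in> Om m" "p \<in> Om m" "\<bar>i\<bar> \<noteq> \<bar>p\<bar>"
    and full: "(k, l, a) \<in> full" "(k', l', a) \<in> full"
    and rel: "\<And>v. row_ops R [(p, i, 1), (i, p, - 1), (p, i, 1), (k, l, a)] v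
      = row_ops R [(k', l', a), (p, i, 1), (i, p, - 1), (p, i, 1)] v"
  shows "weyl p i \<otimes> t k l a = t k' l' a \<otimes> weyl p i"
proof -
  have w: "(p, i, 1) \<in> full" "(i, p, - 1) \<in> full" using assms by auto
  show ?thesis
    using t_relation[of "[(p, i, 1), (i, p, - 1), (p, i, 1), (k, l, a)]"
        "[(k', l', a), (p, i, 1), (i, p, - 1), (p, i, 1)]"] rel full w
    by (simp add: weyl_def t_closed Q.m_assoc del: elem_params_iff)
qed

lemma weyl_short:
  assumes "i \<in> Om m" "p \<in> Om m" "j \<in> Om m" "\<bar>i\<bar> \<noteq> \<bar>p\<bar>" "\<bar>j\<bar> \<noteq> \<bar>p\<bar>" "\<bar>j\<bar> \<noteq> \<bar>i\<bar>" "sgn i = sgn p"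
  shows "weyl p i \<otimes> t i j a = t p j a \<otimes> weyl p i" "weyl p i \<otimes> t j i a = t j p a \<otimes> weyl p i"
proof -
  have full: "(i, j, a) \<in> full" "(p, j, a) \<in> full" "(j, i, a) \<in> full" "(j, p, a) \<in> full"
    using assms by auto
  note rel = row_op_weyl_conj[OF assms(1-3)[THEN Om_nonzero] assms(4-7)]
  show "weyl p i \<otimes> t i j a = t p j a \<otimes> weyl p i"
    by (rule weyl_conj[OF assms(1,2,4) full(1,2) rel(1)])
  show "weyl p i \<otimes> t j i a = t j p a \<otimes> weyl p i"
    by (rule weyl_conj[OF assms(1,2,4) full(3,4) rel(2)])
qed

lemma weyl_long:
  assumes "i \<in> Om m" "p \<in> Om m" "\<bar>i\<bar> \<noteq> \<bar>p\<bar>" "sgn i = sgn p"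
  shows "a \<in> component R (UNIV, Lam R) i (- i) \<Longrightarrow> weyl p i \<otimes> t i (- i) a = t p (- p) a \<otimes> weyl p i"
    and "a \<in> component R (UNIV, Lam R) (- i) i \<Longrightarrow> weyl p i \<otimes> t (- i) i a = t (- p) p a \<otimes> weyl p i"
proof -
  note rel = row_op_weyl_conj_long[OF assms(1,2)[THEN Om_nonzero] assms(3,4)]
  have nz: "i \<noteq> 0" "p \<noteq> 0" using assms by (auto simp: Om_iff)
  note cong = component_sgn_cong[OF assms(4), of "(UNIV, Lam R)"]
    component_sgn_cong[of "- i" "- p" "(UNIV, Lam R)", simplified sgn_minus assms(4), OF refl]
  {
    assume a: "a \<in> component R (UNIV, Lam R) i (- i)"
    then have "(i, - i, a) \<in> full" "(p, - p, a) \<in> full"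
      using assms(1,2) nz cong(1) by (simp_all del: component.simps)
    from weyl_conj[OF assms(1-3) this rel(1)]
    show "weyl p i \<otimes> t i (- i) a = t p (- p) a \<otimes> weyl p i" .
  }
  {
    assume a: "a \<in> component R (UNIV, Lam R) (- i) i"
    then have "(- i, i, a) \<in> full" "(- p, p, a) \<in> full"
      using assms(1,2) nz cong(2) by (simp_all del: component.simps)
    from weyl_conj[OF assms(1-3) this rel(2)]
    show "weyl p i \<otimes> t (- i) i a = t (- p) p a \<otimes> weyl p i" .
  }
qed


section \<open>Mixed commutators modulo the symmetrised product\<close>

text \<open>What the computations use of the quotient by the relative elementary subgroup of the symmetrised
  product. The condition is symmetric in the two form ideals, which halves the case analysis.\<close>

definition kills_product :: "'a set \<times> 'a set \<Rightarrow> 'a set \<times> 'a set \<Rightarrow> bool" where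
  "kills_product X Y \<longleftrightarrow> form_ideal R X \<and> form_ideal R Y
     \<and> (\<forall>(i, j, a) \<in> elem_params R m (sym_prod R X Y). t i j a = \<one>)"

lemma kills_product_sym: "kills_product (I, \<Gamma>) (J, \<Delta>) \<Longrightarrow> kills_product (J, \<Delta>) (I, \<Gamma>)"
  unfolding kills_product_def by (simp only: sym_prod_commute[of I \<Gamma> J \<Delta>]) simp

lemma kills_productD:
  assumes "kills_product X Y" "(i, j, a) \<in> elem_params R m (sym_prod R X Y)"
  shows "t i j a = \<one>"
  using assms unfolding kills_product_def by blast

lemma params_full:
  assumes "form_ideal R X"
  shows "elem_params R m X \<subseteq> full"
  using form_idealD(8)[of "fst X" "snd X"] assms by (intro elem_params_subset) simp

lemma short_params: "(i, j, a) \<in> elem_params R m (I, \<Gamma>)"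
  if "i \<in> Om m" "j \<in> Om m" "\<bar>i\<bar> \<noteq> \<bar>j\<bar>" "a \<in> I"
  using that by auto

lemma short_full: "(i, j, a) \<in> full"
  if "i \<in> Om m" "j \<in> Om m" "\<bar>i\<bar> \<noteq> \<bar>j\<bar>"
  using that by auto

lemma long_params: "(i, - i, a) \<in> elem_params R m X"
  if "i \<in> Om m" "a \<in> component R X i (- i)"
  using that by (auto simp: Om_iff)

lemma long_params': "(- i, i, a) \<in> elem_params R m X"
  if "i \<in> Om m" "a \<in> component R X (- i) i"
  using long_params[of "- i" a X] that by (simp del: elem_params_iff)

subsection \<open>Root subgroups that are not opposite commute\<close>

lemma short_short_commute:
  assumes kill: "kills_product (I, \<Gamma>) (J, \<Delta>)" and ab: "a \<in> I" "b \<in> J"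
    and ijk: "i \<in> Om m" "j \<in> Om m" "k \<in> Om m" "\<bar>i\<bar> \<noteq> \<bar>j\<bar>" "\<bar>j\<bar> \<noteq> \<bar>k\<bar>" "i \<noteq> k"
  shows "t i j a \<otimes> t j k b = t j k b \<otimes> t i j a"
proof -
  have closed: "t i j a \<in> carrier Q" "t j k b \<in> carrier Q"
    using ijk by (intro t_closed short_full; simp)+
  show ?thesis
  proof (cases "k = - i")
    case True
    have "t i (- i) (a * b - dual_entry R i (- i) (a * b)) = \<one>"
      using kill ab ijk
      by (intro kills_productD[OF kill] long_params sym_prod_trace)
        (auto simp: kills_product_def Om_iff)
    then show ?thesis
      using t_short_short_long[OF ijk(1,2,4), of a b] closed True by simp
  next
    case False
    then have ik: "\<bar>i\<bar> \<noteq> \<bar>k\<bar>" using ijk by auto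
    then have "t i k (a * b) = \<one>"
      using ab ijk False sym_prod_short[of a I b J k i]
      by (intro kills_productD[OF kill]) (simp del: component.simps sym_prod.simps)
    then show ?thesis
      using t_short_short[OF ijk(1-5) ik, of a b] closed by simp
  qed
qed

lemma short_long_commute:
  assumes kill: "kills_product (I, \<Gamma>) (J, \<Delta>)" and ab: "a \<in> I" "b \<in> component R (J, \<Delta>) j (- j)"
    and ij: "i \<in> Om m" "j \<in> Om m" "\<bar>i\<bar> \<noteq> \<bar>j\<bar>"
  shows "t i j a \<otimes> t j (- j) b = t j (- j) b \<otimes> t i j a"
proof -
  have nz: "i \<noteq> 0" "j \<noteq> 0" using ij by (auto simp: Om_iff)
  have J: "form_ideal R (J, \<Delta>)" using kill by (simp add: kills_product_def)
  have long: "(j, - j, b) \<in> full"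
    using params_full[OF J] long_params[OF ij(2) ab(2)] by blast
  then have b: "b \<in> component R (UNIV, Lam R) j (- j)" by (simp del: component.simps)
  have closed: "t i j a \<in> carrier Q" "t j (- j) b \<in> carrier Q"
    using ij long by (auto intro!: t_closed short_full simp del: elem_params_iff)
  have "b \<in> J" by (rule component_long_subset[OF J nz(2) ab(2)])
  then have "t i (- j) (a * b) = \<one>"
    using ab(1) ij sym_prod_short[of a I b J "- j" i]
    by (intro kills_productD[OF kill]) (auto simp del: component.simps sym_prod.simps)
  moreover have "t i (- i) (a * b * dual_entry R i j a) = \<one>"
    by (intro kills_productD[OF kill] long_params ij sym_prod_conj ab nz)
  ultimately show ?thesis
    using t_short_long[OF ij b, of a] closed by simp
qed

lemma short_any_long_commute:
  assumes kill: "kills_product (I, \<Gamma>) (J, \<Delta>)" and ab: "a \<in> I" "b \<in> component R (J, \<Delta>) h (- h)"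
    and ijh: "i \<in> Om m" "j \<in> Om m" "h \<in> Om m" "\<bar>i\<bar> \<noteq> \<bar>j\<bar>"
  shows "t i j a \<otimes> t h (- h) b = t h (- h) b \<otimes> t i j a"
proof -
  have I: "form_ideal R (I, \<Gamma>)" and J: "form_ideal R (J, \<Delta>)"
    using kill by (simp_all add: kills_product_def)
  consider "h = j" | "h = - i" | "h \<noteq> j" "h \<noteq> - i" by auto
  then show ?thesis
  proof cases
    case 1
    then show ?thesis using short_long_commute[OF kill] ab ijh by simp
  next
    case 2
    have "t (- j) (- i) (- dual_entry R i j a) \<otimes> t (- i) (- (- i)) b
      = t (- i) (- (- i)) b \<otimes> t (- j) (- i) (- dual_entry R i j a)"
      using ab ijh 2 by (intro short_long_commute[OF kill] dual_entry_in_ideal[OF I]) auto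
    then show ?thesis using t_dual[of i j a] ijh 2 by simp
  next
    case 3
    have "(h, - h, b) \<in> full" using params_full[OF J] long_params[OF ijh(3) ab(2)] by blast
    moreover have "i \<noteq> - h" using 3 by auto
    ultimately show ?thesis
      using 3 ijh by (intro t_commute[OF short_full]) (simp_all del: elem_params_iff)
  qed
qed

text \<open>By duality and by exchanging the two form ideals every case reduces to one of the commutator
  formulas at positions \<open>(i, j)\<close> and \<open>(j, k)\<close>, or to disjoint positions. The exclusion of opposite
  roots is what guarantees \<open>i \<noteq> k\<close> there.\<close>

lemma non_opposite_commute:
  assumes kill: "kills_product (I, \<Gamma>) (J, \<Delta>)"
    and a: "(i, j, a) \<in> elem_params R m (I, \<Gamma>)" and b: "(h, k, b) \<in> elem_params R m (J, \<Delta>)"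
    and non_opp: "\<not> (h = j \<and> k = i)" "\<not> (h = - i \<and> k = - j)"
  shows "t i j a \<otimes> t h k b = t h k b \<otimes> t i j a"
proof -
  have I: "form_ideal R (I, \<Gamma>)" and J: "form_ideal R (J, \<Delta>)"
    using kill by (simp_all add: kills_product_def)
  have full: "(i, j, a) \<in> full" "(h, k, b) \<in> full"
    using a b params_full[OF I] params_full[OF J] by blast+
  have Om: "i \<in> Om m" "j \<in> Om m" "h \<in> Om m" "k \<in> Om m" "i \<noteq> j" "h \<noteq> k"
    using a b by (auto simp del: component.simps)
  consider (long_long) "j = - i" "k = - h" | (short_long) "j \<noteq> - i" "k = - h"
    | (long_short) "j = - i" "k \<noteq> - h" | (short_short) "j \<noteq> - i" "k \<noteq> - h"
    by blast
  then show ?thesis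
  proof cases
    case long_long
    then show ?thesis using non_opp by (intro t_commute full) auto
  next
    case short_long
    then have "\<bar>i\<bar> \<noteq> \<bar>j\<bar>" using Om by auto
    then show ?thesis
      using short_long a b Om by (auto intro!: short_any_long_commute[OF kill] simp del: component.simps)
        (simp add: component_short)
  next
    case long_short
    then have "\<bar>h\<bar> \<noteq> \<bar>k\<bar>" using Om by auto
    then have "t h k b \<otimes> t i (- i) a = t i (- i) a \<otimes> t h k b"
      using long_short a b Om
      by (intro short_any_long_commute[OF kills_product_sym[OF kill]]) (auto simp del: component.simps, simp)
    then show ?thesis using long_short by simp
  next
    case short_short
    then have ne: "\<bar>i\<bar> \<noteq> \<bar>j\<bar>" "\<bar>h\<bar> \<noteq> \<bar>k\<bar>" and ab: "a \<in> I" "b \<in> J" using Om a b by auto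
    define a' where "a' = - dual_entry R i j a"
    define b' where "b' = - dual_entry R h k b"
    have a': "t i j a = t (- j) (- i) a'" "a' \<in> I"
      unfolding a'_def by (rule t_dual[OF Om(1,2) ne(1)], rule dual_entry_in_ideal[OF I ab(1)])
    have b': "t h k b = t (- k) (- h) b'" "b' \<in> J"
      unfolding b'_def by (rule t_dual[OF Om(3,4) ne(2)], rule dual_entry_in_ideal[OF J ab(2)])
    consider "j = h" | "j = - k" | "i = k" | "i = - h" | "j \<noteq> h" "j \<noteq> - k" "i \<noteq> k" "i \<noteq> - h"
      by blast
    then show ?thesis
    proof cases
      case 1
      then show ?thesis using short_short_commute[OF kill ab, of i j k] Om ne non_opp by auto
    next
      case 2
      then show ?thesis
        using short_short_commute[OF kill ab(1) b'(2), of i j "- h"] Om ne non_opp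
        unfolding b'(1) by auto
    next
      case 3
      then show ?thesis
        using short_short_commute[OF kills_product_sym[OF kill] ab(2,1), of h k j] Om ne non_opp
        by auto
    next
      case 4
      then show ?thesis
        using short_short_commute[OF kill a'(2) ab(2), of "- j" "- i" k] Om ne non_opp
        unfolding a'(1) by auto
    next
      case 5
      then show ?thesis by (intro t_commute full)
    qed
  qed
qed

subsection \<open>Elementary commutators of opposite root subgroups are central\<close>

lemma subgroup_left_factor:
  assumes C: "subgroup C Q" and "x \<in> C" "y \<in> C" "z \<in> carrier Q" "x = z \<otimes> y"
  shows "z \<in> C"
proof -
  have "x \<otimes> inv y \<in> C" using assms by (simp add: subgroup.m_closed subgroup.m_inv_closed)
  moreover have "x \<otimes> inv y = z"
    using assms subgroup.mem_carrier[OF C] by (simp add: Q.m_assoc)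
  ultimately show ?thesis by simp
qed

text \<open>A transvection at \<open>(h, k)\<close> away from \<open>p\<close> is the commutator of transvections at \<open>(h, p)\<close> and
  \<open>(p, k)\<close>. A long one at \<open>(h, - h)\<close> is extracted from the short-long formula for
  \<open>(h, q)\<close> and \<open>(q, - q)\<close>, where \<open>q\<close> is \<open>p\<close> or \<open>- p\<close>.\<close>

lemma generation_by_index:
  assumes C: "subgroup C Q" and p: "p \<in> Om m"
    and short: "\<And>q h c. \<bar>q\<bar> = \<bar>p\<bar> \<Longrightarrow> h \<in> Om m \<Longrightarrow> \<bar>h\<bar> \<noteq> \<bar>p\<bar> \<Longrightarrow> t q h c \<in> C"
    and long: "\<And>q c. \<bar>q\<bar> = \<bar>p\<bar> \<Longrightarrow> c \<in> component R (UNIV, Lam R) q (- q) \<Longrightarrow> t q (- q) c \<in> C"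
    and hkc: "(h, k, c) \<in> full"
  shows "t h k c \<in> C"
proof -
  have Om: "h \<in> Om m" "k \<in> Om m" "h \<noteq> k" using hkc by auto
  have right: "t h q c \<in> C" if "\<bar>q\<bar> = \<bar>p\<bar>" "h \<in> Om m" "\<bar>h\<bar> \<noteq> \<bar>p\<bar>" for q h c
  proof -
    have "t h q c = t (- q) (- h) (- dual_entry R h q c)"
      using that p by (intro t_dual) (auto simp: Om_iff)
    then show ?thesis using short[of "- q" "- h"] that by simp
  qed
  show ?thesis
  proof (cases "k = - h")
    case False
    then have hk: "\<bar>h\<bar> \<noteq> \<bar>k\<bar>" using Om by auto
    consider "\<bar>h\<bar> = \<bar>p\<bar>" | "\<bar>k\<bar> = \<bar>p\<bar>" | "\<bar>h\<bar> \<noteq> \<bar>p\<bar>" "\<bar>k\<bar> \<noteq> \<bar>p\<bar>" by blast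
    then show ?thesis
    proof cases
      case 1
      then show ?thesis using short Om hk by simp
    next
      case 2
      then show ?thesis using right Om hk by simp
    next
      case 3
      have "t h p c \<otimes> t p k 1 = t h k c \<otimes> t p k 1 \<otimes> t h p c"
        using t_short_short[of h p k c 1] Om p 3 hk by simp
      moreover have mem: "t h p c \<in> C" "t p k 1 \<in> C" using short right Om p 3 by auto
      moreover note car = mem[THEN subgroup.mem_carrier[OF C]] t_closed[OF hkc]
      ultimately have "t h p c \<otimes> t p k 1 = t h k c \<otimes> (t p k 1 \<otimes> t h p c)"
        by (simp add: Q.m_assoc)
      then show ?thesis
        by (rule subgroup_left_factor[OF C subgroup.m_closed[OF C mem]
              subgroup.m_closed[OF C mem(2,1)] t_closed[OF hkc]])
    qed
  next
    case True
    show ?thesis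
    proof (cases "\<bar>h\<bar> = \<bar>p\<bar>")
      case hp: True
      then show ?thesis using long hkc True by (simp del: component.simps)
    next
      case hp: False
      \<comment> \<open>Equal signs make the dual entry of 1 equal to 1 and identify the long parameter sets.\<close>
      define q where "q = (if sgn p = sgn h then p else - p)"
      have q: "q \<in> Om m" "\<bar>q\<bar> = \<bar>p\<bar>" "sgn q = sgn h" "\<bar>h\<bar> \<noteq> \<bar>q\<bar>" "h \<noteq> 0" "q \<noteq> 0"
        using p Om hp by (auto simp: q_def Om_iff sgn_if)
      have c: "c \<in> component R (UNIV, Lam R) q (- q)"
        using hkc True component_sgn_cong[OF q(3)] by (simp del: component.simps)
      have "t h q 1 \<otimes> t q (- q) c = t h (- q) c \<otimes> t h (- h) c \<otimes> t q (- q) c \<otimes> t h q 1"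
        using t_short_long[OF Om(1) q(1,4) c, of 1] dual_entry_one[of h q] q by simp
      moreover have mem: "t h q 1 \<in> C" "t h (- q) c \<in> C" "t q (- q) c \<in> C"
        using right long c q Om hp by auto
      moreover have hh: "t h (- h) c \<in> carrier Q" using t_closed[OF hkc] True by simp
      moreover note car = mem[THEN subgroup.mem_carrier[OF C]]
      ultimately have "t h q 1 \<otimes> t q (- q) c
          = t h (- q) c \<otimes> (t h (- h) c \<otimes> (t q (- q) c \<otimes> t h q 1))"
        by (simp add: Q.m_assoc)
      then have "inv (t h (- q) c) \<otimes> (t h q 1 \<otimes> t q (- q) c)
          = t h (- h) c \<otimes> (t q (- q) c \<otimes> t h q 1)"
        by (subst Q.inv_solve_left') (simp_all only: Q.m_closed car hh)
      then have "t h (- h) c \<in> C"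
        by (rule subgroup_left_factor[OF C _ _ hh, rotated 2])
          (intro subgroup.m_closed[OF C] subgroup.m_inv_closed[OF C] mem)+
      then show ?thesis using True by simp
    qed
  qed
qed

lemma commutator_commute_sym:
  assumes "x \<in> carrier Q" "y \<in> carrier Q" "z \<in> carrier Q"
    and "Q.commutator y x \<otimes> z = z \<otimes> Q.commutator y x"
  shows "Q.commutator x y \<otimes> z = z \<otimes> Q.commutator x y"
proof -
  have "z \<otimes> inv (Q.commutator y x) = inv (Q.commutator y x) \<otimes> z"
    using assms by (intro Q.commute_inv) auto
  then show ?thesis using assms by (simp add: Q.inv_commutator)
qed

lemma commutator_commute_both:
  assumes "x \<in> carrier Q" "y \<in> carrier Q" "z \<in> carrier Q"
    and "x \<otimes> z = z \<otimes> x" "y \<otimes> z = z \<otimes> y"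
  shows "Q.commutator x y \<otimes> z = z \<otimes> Q.commutator x y"
  using Q.conj_commutator[of z x y x y] assms by simp

lemma central_of_index:
  assumes Y: "Y \<in> carrier Q" and p: "p \<in> Om m"
    and short: "\<And>q h c. \<bar>q\<bar> = \<bar>p\<bar> \<Longrightarrow> h \<in> Om m \<Longrightarrow> \<bar>h\<bar> \<noteq> \<bar>p\<bar> \<Longrightarrow> Y \<otimes> t q h c = t q h c \<otimes> Y"
    and long: "\<And>q c. \<bar>q\<bar> = \<bar>p\<bar> \<Longrightarrow> c \<in> component R (UNIV, Lam R) q (- q) \<Longrightarrow>
      Y \<otimes> t q (- q) c = t q (- q) c \<otimes> Y"
    and hkc: "(h, k, c) \<in> full"
  shows "Y \<otimes> t h k c = t h k c \<otimes> Y"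
proof -
  have Om: "q \<in> Om m" if "\<bar>q\<bar> = \<bar>p\<bar>" for q using p that by (auto simp: Om_iff)
  have "t h k c \<in> {g \<in> carrier Q. Y \<otimes> g = g \<otimes> Y}"
  proof (rule generation_by_index[OF Q.subgroup_centralizer[OF Y] p _ _ hkc])
    fix q h c assume *: "\<bar>q\<bar> = \<bar>p\<bar>" "h \<in> Om m" "\<bar>h\<bar> \<noteq> \<bar>p\<bar>"
    then show "t q h c \<in> {g \<in> carrier Q. Y \<otimes> g = g \<otimes> Y}"
      using short[OF *, of c] Om[OF *(1)] by (auto intro!: t_closed short_full simp del: elem_params_iff)
  next
    fix q c assume *: "\<bar>q\<bar> = \<bar>p\<bar>" "c \<in> component R (UNIV, Lam R) q (- q)"
    then show "t q (- q) c \<in> {g \<in> carrier Q. Y \<otimes> g = g \<otimes> Y}"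
      using long[OF *] Om[OF *(1)] by (auto intro!: t_closed long_params simp del: elem_params_iff component.simps)
  qed
  then show ?thesis by simp
qed

text \<open>Here \<open>u = t p j (c * a)\<close>. Since \<open>p\<close> avoids \<open>i, j, - i, - j\<close>, no long roots occur.\<close>

lemma short_commutator_commute_base:
  assumes kill: "kills_product (I, \<Gamma>) (J, \<Delta>)" and ab: "a \<in> I" "b \<in> J"
    and ijp: "i \<in> Om m" "j \<in> Om m" "p \<in> Om m" "\<bar>i\<bar> \<noteq> \<bar>j\<bar>" "\<bar>p\<bar> \<noteq> \<bar>i\<bar>" "\<bar>p\<bar> \<noteq> \<bar>j\<bar>"
  shows "Q.commutator (t i j a) (t j i b) \<otimes> t p i c = t p i c \<otimes> Q.commutator (t i j a) (t j i b)"
proof (rule Q.commute_commutator[where u = "t p j (c * a)"])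
  have full: "(i, j, a) \<in> full" "(j, i, b) \<in> full" "(p, i, c) \<in> full" "(p, j, c * a) \<in> full"
    using ijp by (intro short_full; simp)+
  then show "t i j a \<in> carrier Q" "t j i b \<in> carrier Q" "t p i c \<in> carrier Q" "t p j (c * a) \<in> carrier Q"
    by (simp_all only: t_closed)
  show "t p i c \<otimes> t i j a = t p j (c * a) \<otimes> t i j a \<otimes> t p i c"
    using t_short_short[of p i j c a] ijp by simp
  show "t p i c \<otimes> t j i b = t j i b \<otimes> t p i c"
    using ijp by (intro t_commute full) (auto simp: Om_iff)
  show "t p j (c * a) \<otimes> t i j a = t i j a \<otimes> t p j (c * a)"
    using ijp by (intro t_commute full) (auto simp: Om_iff)
  have "c * a \<in> I" using kill ab form_idealD(3) unfolding kills_product_def by blast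
  then show "t p j (c * a) \<otimes> t j i b = t j i b \<otimes> t p j (c * a)"
    using ijp by (intro short_short_commute[OF kill _ ab(2)]) auto
qed

lemma obtain_index:
  assumes "3 \<le> m"
  obtains p where "p \<in> Om m" "\<bar>p\<bar> \<noteq> \<bar>i\<bar>" "\<bar>p\<bar> \<noteq> \<bar>j\<bar>"
proof -
  have "\<exists>p \<in> {1, 2, 3 :: int}. p \<noteq> \<bar>i\<bar> \<and> p \<noteq> \<bar>j\<bar>" by auto
  then obtain p :: int where "p \<in> {1, 2, 3}" "p \<noteq> \<bar>i\<bar>" "p \<noteq> \<bar>j\<bar>" by blast
  with assms show ?thesis by (intro that[of p]) (auto simp: Om_iff)
qed

text \<open>The base case treats \<open>t p i\<close>. Exchanging the two factors gives \<open>t p j\<close>, and rewriting both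
  factors at their dual positions gives \<open>t p (- j)\<close> and \<open>t p (- i)\<close>. All other
  generators involving \<open>p\<close> commute with both factors.\<close>

lemma short_commutator_central:
  assumes kill: "kills_product (I, \<Gamma>) (J, \<Delta>)" and ab: "a \<in> I" "b \<in> J" and m: "3 \<le> m"
    and ij: "i \<in> Om m" "j \<in> Om m" "\<bar>i\<bar> \<noteq> \<bar>j\<bar>" and hkc: "(h, k, c) \<in> full"
  shows "Q.commutator (t i j a) (t j i b) \<otimes> t h k c = t h k c \<otimes> Q.commutator (t i j a) (t j i b)"
    (is "?Y \<otimes> _ = _")
proof -
  obtain p where p: "p \<in> Om m" "\<bar>p\<bar> \<noteq> \<bar>i\<bar>" "\<bar>p\<bar> \<noteq> \<bar>j\<bar>" by (rule obtain_index[OF m])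
  have full: "(i, j, a) \<in> full" "(j, i, b) \<in> full" using ij by (intro short_full; simp)+
  note closed = full[THEN t_closed]
  have I: "form_ideal R (I, \<Gamma>)" and J: "form_ideal R (J, \<Delta>)"
    using kill by (simp_all add: kills_product_def)
  have pair: "Q.commutator (t i j a) (t j i b) \<otimes> t q l c = t q l c \<otimes> Q.commutator (t i j a) (t j i b)"
    if q: "\<bar>q\<bar> = \<bar>p\<bar>" and l: "l = i \<or> l = j" and ab: "a \<in> I" "b \<in> J"
      and ij: "i \<in> Om m" "j \<in> Om m" "\<bar>i\<bar> \<noteq> \<bar>j\<bar>" and p: "\<bar>p\<bar> \<noteq> \<bar>i\<bar>" "\<bar>p\<bar> \<noteq> \<bar>j\<bar>" for i j a b q l c
  proof -
    have qOm: "q \<in> Om m" using \<open>p \<in> Om m\<close> q by (auto simp: Om_iff)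
    from l show ?thesis
    proof
      assume "l = i"
      then show ?thesis using ij p q qOm by (auto intro!: short_commutator_commute_base[OF kill ab])
    next
      assume l: "l = j"
      have comm: "Q.commutator (t j i b) (t i j a) \<otimes> t q j c = t q j c \<otimes> Q.commutator (t j i b) (t i j a)"
        using ij p q qOm
        by (intro short_commutator_commute_base[OF kills_product_sym[OF kill] ab(2,1)]) auto
      have closed: "t i j a \<in> carrier Q" "t j i b \<in> carrier Q" "t q j c \<in> carrier Q"
        using ij p q qOm by (intro t_closed short_full; simp)+
      show ?thesis unfolding l by (rule commutator_commute_sym[OF closed comm])
    qed
  qed
  show ?thesis
  proof (rule central_of_index[OF _ p(1) _ _ hkc])
    show "?Y \<in> carrier Q" using closed by simp
  next
    fix q l c assume q: "\<bar>q\<bar> = \<bar>p\<bar>" and l: "l \<in> Om m" "\<bar>l\<bar> \<noteq> \<bar>p\<bar>"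
    have qOm: "q \<in> Om m" using p q by (auto simp: Om_iff)
    have z: "(q, l, c) \<in> full" using qOm q l by (intro short_full) auto
    consider "l = i \<or> l = j" | "l = - j \<or> l = - i" | "l \<notin> {i, j, - i, - j}" by blast
    then show "?Y \<otimes> t q l c = t q l c \<otimes> ?Y"
    proof cases
      case 1
      then show ?thesis using pair q ab ij p by blast
    next
      case 2
      have "t i j a = t (- j) (- i) (- dual_entry R i j a)" "t j i b = t (- i) (- j) (- dual_entry R j i b)"
        using ij by (auto intro!: t_dual)
      then show ?thesis
        using pair[OF q 2 dual_entry_in_ideal[OF I ab(1)] dual_entry_in_ideal[OF J ab(2)]] ij p by simp
    next
      case 3
      then show ?thesis
        using closed t_closed[OF z] ij p q
        by (intro commutator_commute_both[OF closed t_closed[OF z]]) (auto intro!: t_commute full z simp del: elem_params_iff)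
    qed
  next
    fix q c assume q: "\<bar>q\<bar> = \<bar>p\<bar>" and c: "c \<in> component R (UNIV, Lam R) q (- q)"
    have qOm: "q \<in> Om m" using p q by (auto simp: Om_iff)
    have z: "(q, - q, c) \<in> full" using qOm c by (rule long_params)
    show "?Y \<otimes> t q (- q) c = t q (- q) c \<otimes> ?Y"
      using closed t_closed[OF z] ij p q
      by (intro commutator_commute_both[OF closed t_closed[OF z]]) (auto intro!: t_commute full z simp del: elem_params_iff)
  qed
qed

text \<open>Here the short-long formula contributes two factors to \<open>u\<close>, a short one at \<open>(p, - i)\<close> and a
  long one at \<open>(p, - p)\<close>. The short one commutes with \<open>t (- i) i b\<close> because both parameters in
  their commutator lie in the symmetrised product.\<close>

lemma long_commutator_commute_base:
  assumes kill: "kills_product (I, \<Gamma>) (J, \<Delta>)"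
    and ab: "a \<in> component R (I, \<Gamma>) i (- i)" "b \<in> component R (J, \<Delta>) (- i) i"
    and ip: "i \<in> Om m" "p \<in> Om m" "\<bar>p\<bar> \<noteq> \<bar>i\<bar>"
  shows "Q.commutator (t i (- i) a) (t (- i) i b) \<otimes> t p i c
    = t p i c \<otimes> Q.commutator (t i (- i) a) (t (- i) i b)"
proof -
  have I: "form_ideal R (I, \<Gamma>)" and J: "form_ideal R (J, \<Delta>)"
    using kill by (simp_all add: kills_product_def)
  let ?d = "c * a * dual_entry R p i c"
  have nz: "i \<noteq> 0" "p \<noteq> 0" using ip by (auto simp: Om_iff)
  have long: "(i, - i, a) \<in> full" "(- i, i, b) \<in> full"
    using params_full[OF I] params_full[OF J] long_params[OF ip(1) ab(1)]
      long_params'[OF ip(1) ab(2)] by blast+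
  then have a: "a \<in> component R (UNIV, Lam R) i (- i)" by (simp del: component.simps)
  have full: "(p, i, c) \<in> full" "(p, - i, c * a) \<in> full"
    using ip by (intro short_full; simp)+
  have d: "(p, - p, ?d) \<in> full"
    by (intro long_params ip component_long_conj[OF form_ideal_UNIV nz(2,1) a])
  note closed = long[THEN t_closed] full[THEN t_closed] t_closed[OF d]
  show ?thesis
  proof (rule Q.commute_commutator[where u = "t p (- i) (c * a) \<otimes> t p (- p) ?d"])
    show "t p i c \<otimes> t i (- i) a = t p (- i) (c * a) \<otimes> t p (- p) ?d \<otimes> t i (- i) a \<otimes> t p i c"
      by (rule t_short_long[OF ip(2,1,3) a])
    show "t p i c \<otimes> t (- i) i b = t (- i) i b \<otimes> t p i c"
      using ip nz by (intro t_commute long full) auto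
    have comm_mult: "u \<otimes> v \<otimes> x = x \<otimes> (u \<otimes> v)"
      if "u \<in> carrier Q" "v \<in> carrier Q" "x \<in> carrier Q" "u \<otimes> x = x \<otimes> u" "v \<otimes> x = x \<otimes> v" for u v x
      using that by (metis Q.m_assoc)
    have "t p (- i) (c * a) \<otimes> t i (- i) a = t i (- i) a \<otimes> t p (- i) (c * a)"
      using ip nz by (intro t_commute long full) auto
    moreover have "t p (- p) ?d \<otimes> t i (- i) a = t i (- i) a \<otimes> t p (- p) ?d"
      using ip nz by (intro t_commute long d) auto
    ultimately show "t p (- i) (c * a) \<otimes> t p (- p) ?d \<otimes> t i (- i) a
        = t i (- i) a \<otimes> (t p (- i) (c * a) \<otimes> t p (- p) ?d)"
      using closed by (intro comm_mult)
    have "c * a \<in> I"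
      using component_long_subset[OF I nz(1) ab(1)] form_idealD(3)[OF I] by blast
    then have "t p (- i) (c * a) \<otimes> t (- i) (- (- i)) b = t (- i) (- (- i)) b \<otimes> t p (- i) (c * a)"
      using ip ab(2) by (intro short_long_commute[OF kill]) auto
    moreover have "t p (- p) ?d \<otimes> t (- i) i b = t (- i) i b \<otimes> t p (- p) ?d"
      using ip nz by (intro t_commute long d) auto
    ultimately show "t p (- i) (c * a) \<otimes> t p (- p) ?d \<otimes> t (- i) i b
        = t (- i) i b \<otimes> (t p (- i) (c * a) \<otimes> t p (- p) ?d)"
      using closed by (intro comm_mult) auto
  qed (use closed in auto)
qed

lemma long_commutator_central:
  assumes kill: "kills_product (I, \<Gamma>) (J, \<Delta>)" and m: "3 \<le> m"
    and ab: "a \<in> component R (I, \<Gamma>) i (- i)" "b \<in> component R (J, \<Delta>) (- i) i"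
    and i: "i \<in> Om m" and hkc: "(h, k, c) \<in> full"
  shows "Q.commutator (t i (- i) a) (t (- i) i b) \<otimes> t h k c
    = t h k c \<otimes> Q.commutator (t i (- i) a) (t (- i) i b)"
    (is "?Y \<otimes> _ = _")
proof -
  obtain p where p: "p \<in> Om m" "\<bar>p\<bar> \<noteq> \<bar>i\<bar>" by (rule obtain_index[OF m])
  have I: "form_ideal R (I, \<Gamma>)" and J: "form_ideal R (J, \<Delta>)"
    using kill by (simp_all add: kills_product_def)
  have full: "(i, - i, a) \<in> full" "(- i, i, b) \<in> full"
    using params_full[OF I] params_full[OF J] long_params[OF i ab(1)]
      long_params'[OF i ab(2)] by blast+
  note closed = full[THEN t_closed]
  show ?thesis
  proof (rule central_of_index[OF _ p(1) _ _ hkc])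
    show "?Y \<in> carrier Q" using closed by simp
  next
    fix q l c assume q: "\<bar>q\<bar> = \<bar>p\<bar>" and l: "l \<in> Om m" "\<bar>l\<bar> \<noteq> \<bar>p\<bar>"
    have qOm: "q \<in> Om m" using p q by (auto simp: Om_iff)
    have z: "(q, l, c) \<in> full" using qOm q l by (intro short_full) auto
    consider "l = i" | "l = - i" | "l \<notin> {i, - i}" by blast
    then show "?Y \<otimes> t q l c = t q l c \<otimes> ?Y"
    proof cases
      case 1
      then show ?thesis
        using long_commutator_commute_base[OF kill ab i qOm] q p by simp
    next
      case 2
      have "Q.commutator (t (- i) (- (- i)) b) (t (- (- i)) (- i) a) \<otimes> t q (- i) c
        = t q (- i) c \<otimes> Q.commutator (t (- i) (- (- i)) b) (t (- (- i)) (- i) a)"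
        using ab i q p qOm
        by (intro long_commutator_commute_base[OF kills_product_sym[OF kill]]) auto
      then show ?thesis
        unfolding 2 minus_minus using 2 closed t_closed[OF z]
        by (intro commutator_commute_sym[of "t i (- i) a"]) simp_all
    next
      case 3
      then show ?thesis
        using closed t_closed[OF z] i p q
        by (intro commutator_commute_both[OF closed t_closed[OF z]]) (auto intro!: t_commute full z simp del: elem_params_iff)
    qed
  next
    fix q c assume q: "\<bar>q\<bar> = \<bar>p\<bar>" and c: "c \<in> component R (UNIV, Lam R) q (- q)"
    have qOm: "q \<in> Om m" using p q by (auto simp: Om_iff)
    have z: "(q, - q, c) \<in> full" using qOm c by (rule long_params)
    show "?Y \<otimes> t q (- q) c = t q (- q) c \<otimes> ?Y"
      using closed t_closed[OF z] i p q
      by (intro commutator_commute_both[OF closed t_closed[OF z]]) (auto intro!: t_commute full z simp del: elem_params_iff)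
  qed
qed

end

section \<open>Moving elementary commutators to smaller indices\<close>

context elementary_hom
begin

lemma commutator_eq_of_conj:
  assumes "w \<in> carrier Q" "x \<in> carrier Q" "y \<in> carrier Q" "x' \<in> carrier Q" "y' \<in> carrier Q"
    and "w \<otimes> x = x' \<otimes> w" "w \<otimes> y = y' \<otimes> w"
    and "Q.commutator x y \<otimes> w = w \<otimes> Q.commutator x y"
  shows "Q.commutator x y = Q.commutator x' y'"
proof -
  have "Q.commutator x y \<otimes> w = Q.commutator x' y' \<otimes> w"
    using Q.conj_commutator[OF assms(1-7)] assms(8) by simp
  then show ?thesis using assms by simp
qed

lemma commute_weyl:
  assumes Y: "Y \<in> carrier Q" and ip: "i \<in> Om m" "p \<in> Om m" "\<bar>i\<bar> \<noteq> \<bar>p\<bar>"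
    and central: "\<And>h k c. (h, k, c) \<in> full \<Longrightarrow> Y \<otimes> t h k c = t h k c \<otimes> Y"
  shows "Y \<otimes> weyl p i = weyl p i \<otimes> Y"
proof -
  have full: "(p, i, 1) \<in> full" "(i, p, - 1) \<in> full" using ip by (intro short_full; simp)+
  let ?C = "{g \<in> carrier Q. Y \<otimes> g = g \<otimes> Y}"
  have "t p i 1 \<in> ?C" "t i p (- 1) \<in> ?C" using central full t_closed by blast+
  then have "weyl p i \<in> ?C"
    unfolding weyl_def using subgroup.m_closed[OF Q.subgroup_centralizer[OF Y]] by blast
  then show ?thesis by simp
qed

lemma short_commutator_move:
  assumes kill: "kills_product (I, \<Gamma>) (J, \<Delta>)" and ab: "a \<in> I" "b \<in> J" and m: "3 \<le> m"
    and ijp: "i \<in> Om m" "p \<in> Om m" "j \<in> Om m" "\<bar>i\<bar> \<noteq> \<bar>p\<bar>" "\<bar>j\<bar> \<noteq> \<bar>p\<bar>" "\<bar>j\<bar> \<noteq> \<bar>i\<bar>" "sgn i = sgn p"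
  shows "Q.commutator (t i j a) (t j i b) = Q.commutator (t p j a) (t j p b)"
proof -
  have full: "(i, j, a) \<in> full" "(j, i, b) \<in> full" "(p, j, a) \<in> full" "(j, p, b) \<in> full"
    using ijp by (intro short_full; simp)+
  note closed = full[THEN t_closed]
  show ?thesis
  proof (rule commutator_eq_of_conj[OF weyl_closed[OF ijp(1,2,4)] closed
        weyl_short(1)[OF ijp] weyl_short(2)[OF ijp]])
    show "Q.commutator (t i j a) (t j i b) \<otimes> weyl p i = weyl p i \<otimes> Q.commutator (t i j a) (t j i b)"
      using ijp(6) by (intro commute_weyl ijp short_commutator_central[OF kill ab m]
          Q.commutator_closed closed) auto
  qed
qed

lemma long_commutator_move:
  assumes kill: "kills_product (I, \<Gamma>) (J, \<Delta>)" and m: "3 \<le> m"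
    and ab: "a \<in> component R (I, \<Gamma>) i (- i)" "b \<in> component R (J, \<Delta>) (- i) i"
    and ip: "i \<in> Om m" "p \<in> Om m" "\<bar>i\<bar> \<noteq> \<bar>p\<bar>" "sgn i = sgn p"
  shows "Q.commutator (t i (- i) a) (t (- i) i b) = Q.commutator (t p (- p) a) (t (- p) p b)"
proof -
  have I: "form_ideal R (I, \<Gamma>)" and J: "form_ideal R (J, \<Delta>)"
    using kill by (simp_all add: kills_product_def)
  have ab': "a \<in> component R (I, \<Gamma>) p (- p)" "b \<in> component R (J, \<Delta>) (- p) p"
    using ab component_sgn_cong[OF ip(4)] component_sgn_cong[of "- i" "- p"] ip(4)
    by (simp_all add: sgn_minus del: component.simps)
  have full: "(i, - i, a) \<in> full" "(- i, i, b) \<in> full" "(p, - p, a) \<in> full" "(- p, p, b) \<in> full"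
    using params_full[OF I] params_full[OF J] long_params[OF ip(1) ab(1)] long_params'[OF ip(1) ab(2)]
      long_params[OF ip(2) ab'(1)] long_params'[OF ip(2) ab'(2)] by blast+
  note closed = full[THEN t_closed]
  have "a \<in> component R (UNIV, Lam R) i (- i)" "b \<in> component R (UNIV, Lam R) (- i) i"
    using full by (simp_all del: component.simps)
  note w = weyl_long(1)[OF ip this(1)] weyl_long(2)[OF ip this(2)]
  show ?thesis
  proof (rule commutator_eq_of_conj[OF weyl_closed[OF ip(1-3)] closed w])
    show "Q.commutator (t i (- i) a) (t (- i) i b) \<otimes> weyl p i
      = weyl p i \<otimes> Q.commutator (t i (- i) a) (t (- i) i b)"
      by (intro commute_weyl ip long_commutator_central[OF kill m ab] Q.commutator_closed closed)
  qed
qed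

definition opposite_commutators :: "nat \<Rightarrow> 'a set \<times> 'a set \<Rightarrow> 'a set \<times> 'a set \<Rightarrow> 'q set" where
  "opposite_commutators n X Y = {Q.commutator (t i j a) (t j i b) | i j a b.
     (i, j, a) \<in> elem_params R n X \<and> (j, i, b) \<in> elem_params R n Y}"

lemma short_commutator_stable_left:
  assumes kill: "kills_product (I, \<Gamma>) (J, \<Delta>)" and ab: "a \<in> I" "b \<in> J" and n: "m = Suc n" "2 \<le> n"
    and ij: "i \<in> Om m" "j \<in> Om m" "\<bar>i\<bar> \<noteq> \<bar>j\<bar>" and j: "j \<in> Om n"
  shows "Q.commutator (t i j a) (t j i b) \<in> opposite_commutators n (I, \<Gamma>) (J, \<Delta>)"
proof (cases "i \<in> Om n")
  case True
  then have "(i, j, a) \<in> elem_params R n (I, \<Gamma>)" "(j, i, b) \<in> elem_params R n (J, \<Delta>)"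
    using ij j ab by auto
  then show ?thesis unfolding opposite_commutators_def by blast
next
  case False
  then have im: "\<bar>i\<bar> = int m" using ij n by (auto simp: Om_iff)
  \<comment> \<open>An index of the sign of \<open>i\<close> that avoids \<open>j\<close> and \<open>- j\<close>; this uses \<open>2 \<le> n\<close>.\<close>
  define p where "p = (if \<bar>j\<bar> = 1 then 2 else 1) * sgn i"
  have p: "p \<in> Om n" "sgn i = sgn p" "\<bar>j\<bar> \<noteq> \<bar>p\<bar>" "\<bar>i\<bar> \<noteq> \<bar>p\<bar>"
    using im n ij(1) by (auto simp: p_def Om_iff sgn_if)
  then have "p \<in> Om m" using n Om_Suc by auto
  then have "Q.commutator (t i j a) (t j i b) = Q.commutator (t p j a) (t j p b)"
    using n p ij by (intro short_commutator_move[OF kill ab]) auto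
  moreover have "(p, j, a) \<in> elem_params R n (I, \<Gamma>)" "(j, p, b) \<in> elem_params R n (J, \<Delta>)"
    using p j ab by auto
  ultimately show ?thesis unfolding opposite_commutators_def by blast
qed

text \<open>At a short position at most one of the two indices has absolute value \<open>n + 1\<close>. If it is the
  second one, passing to the dual position makes it the first.\<close>

lemma opposite_commutator_stable:
  assumes kill: "kills_product (I, \<Gamma>) (J, \<Delta>)" and n: "m = Suc n" "2 \<le> n"
    and a: "(i, j, a) \<in> elem_params R m (I, \<Gamma>)" and b: "(j, i, b) \<in> elem_params R m (J, \<Delta>)"
  shows "Q.commutator (t i j a) (t j i b) \<in> opposite_commutators n (I, \<Gamma>) (J, \<Delta>)"
proof -
  have I: "form_ideal R (I, \<Gamma>)" and J: "form_ideal R (J, \<Delta>)"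
    using kill by (simp_all add: kills_product_def)
  have Om: "i \<in> Om m" "j \<in> Om m" "i \<noteq> j"
    using a by (auto simp del: component.simps)
  show ?thesis
  proof (cases "j = - i")
    case False
    then have ne: "\<bar>i\<bar> \<noteq> \<bar>j\<bar>" and ab: "a \<in> I" "b \<in> J" using Om a b by auto
    show ?thesis
    proof (cases "j \<in> Om n")
      case True
      then show ?thesis by (intro short_commutator_stable_left[OF kill ab n] Om ne)
    next
      case False
      then have "- i \<in> Om n" using Om ne n by (auto simp: Om_iff)
      then have "Q.commutator (t (- j) (- i) (- dual_entry R i j a)) (t (- i) (- j) (- dual_entry R j i b))
          \<in> opposite_commutators n (I, \<Gamma>) (J, \<Delta>)"
        using Om ne dual_entry_in_ideal[OF I ab(1)] dual_entry_in_ideal[OF J ab(2)]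
        by (intro short_commutator_stable_left[OF kill _ _ n]) auto
      moreover have "\<bar>j\<bar> \<noteq> \<bar>i\<bar>" using ne by simp
      ultimately show ?thesis
        by (simp only: t_dual[OF Om(1,2) ne, of a] t_dual[OF Om(2,1) \<open>\<bar>j\<bar> \<noteq> \<bar>i\<bar>\<close>, of b])
    qed
  next
    case True
    show ?thesis
    proof (cases "i \<in> Om n")
      case i: True
      then have "(i, j, a) \<in> elem_params R n (I, \<Gamma>)" "(j, i, b) \<in> elem_params R n (J, \<Delta>)"
        using a b True by (simp_all del: component.simps)
      then show ?thesis unfolding opposite_commutators_def by blast
    next
      case False
      then have im: "\<bar>i\<bar> = int m" using Om n by (auto simp: Om_iff)
      define p where "p = sgn i"
      have p: "p \<in> Om n" "sgn i = sgn p" "\<bar>i\<bar> \<noteq> \<bar>p\<bar>"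
        using im n Om(1) by (auto simp: p_def Om_iff sgn_if)
      then have pm: "p \<in> Om m" using n Om_Suc by auto
      have ab: "a \<in> component R (I, \<Gamma>) i (- i)" "b \<in> component R (J, \<Delta>) (- i) i"
        using a b True by (simp_all del: component.simps)
      have "Q.commutator (t i (- i) a) (t (- i) i b) = Q.commutator (t p (- p) a) (t (- p) p b)"
        using n by (intro long_commutator_move[OF kill _ ab Om(1) pm p(3,2)]) simp
      moreover have "a \<in> component R (I, \<Gamma>) p (- p)" "b \<in> component R (J, \<Delta>) (- p) p"
        using ab component_sgn_cong[OF p(2)] component_sgn_cong[of "- i" "- p"] p(2)
        by (simp_all add: sgn_minus del: component.simps)
      then have "(p, - p, a) \<in> elem_params R n (I, \<Gamma>)" "(- p, p, b) \<in> elem_params R n (J, \<Delta>)"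
        using p(1) by (auto simp: Om_iff simp del: component.simps)
      ultimately show ?thesis unfolding opposite_commutators_def True by blast
    qed
  qed
qed

lemma gen_commutator_stable:
  assumes kill: "kills_product (I, \<Gamma>) (J, \<Delta>)" and n: "m = Suc n" "2 \<le> n"
    and a: "(i, j, a) \<in> elem_params R m (I, \<Gamma>)" and b: "(h, k, b) \<in> elem_params R m (J, \<Delta>)"
  shows "Q.commutator (t i j a) (t h k b) \<in> generate Q (opposite_commutators n (I, \<Gamma>) (J, \<Delta>))"
proof -
  have I: "form_ideal R (I, \<Gamma>)" and J: "form_ideal R (J, \<Delta>)"
    using kill by (simp_all add: kills_product_def)
  have closed: "t i j a \<in> carrier Q" "t h k b \<in> carrier Q"
    using params_full[OF I] params_full[OF J] a b t_closed by blast+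
  have Om: "h \<in> Om m" "k \<in> Om m" "h \<noteq> k" "i \<in> Om m"
    using a b by (auto simp del: component.simps)
  consider "h = j" "k = i" | "h = - i" "k = - j" "j \<noteq> - i" | "\<not> (h = j \<and> k = i)" "\<not> (h = - i \<and> k = - j)"
    by fastforce
  then show ?thesis
  proof cases
    case 1
    then show ?thesis using opposite_commutator_stable[OF kill n a] b by (auto intro: generate.incl)
  next
    case 2
    then have hk: "\<bar>h\<bar> \<noteq> \<bar>k\<bar>" and bJ: "b \<in> J" using Om b by auto
    have "(j, i, - dual_entry R h k b) \<in> elem_params R m (J, \<Delta>)"
      using 2 Om hk dual_entry_in_ideal[OF J bJ] by (intro short_params) auto
    then have "Q.commutator (t i j a) (t j i (- dual_entry R h k b))
        \<in> opposite_commutators n (I, \<Gamma>) (J, \<Delta>)"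
      by (rule opposite_commutator_stable[OF kill n a])
    moreover have "t h k b = t j i (- dual_entry R h k b)"
      using t_dual[OF Om(1,2) hk, of b] 2 by simp
    ultimately show ?thesis by (auto intro: generate.incl)
  next
    case 3
    then have "Q.commutator (t i j a) (t h k b) = \<one>"
      using non_opposite_commute[OF kill a b] Q.commutator_eq_one_iff[OF closed] by blast
    then show ?thesis by (simp add: generate.one)
  qed
qed

lemma opposite_commutators_closed:
  assumes "form_ideal R X" "form_ideal R Y" "n \<le> m"
  shows "opposite_commutators n X Y \<subseteq> carrier Q"
proof -
  have "elem_params R n Z \<subseteq> elem_params R m Z" for Z
    using assms(3) by (auto simp: elem_params_def Om_iff simp del: component.simps)
  then have "elem_params R n X \<subseteq> full" "elem_params R n Y \<subseteq> full"
    using params_full assms(1,2) by blast+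
  then show ?thesis
    unfolding opposite_commutators_def by (auto intro!: Q.commutator_closed t_closed simp del: elem_params_iff)
qed

text \<open>Fixing the transvection first, its centraliser is a subgroup that contains all elementary
  commutators, hence everything that they generate.\<close>

lemma generated_commutators_central:
  assumes kill: "kills_product (I, \<Gamma>) (J, \<Delta>)" and n: "n \<le> m" "3 \<le> m"
    and h: "h \<in> generate Q (opposite_commutators n (I, \<Gamma>) (J, \<Delta>))" and z: "(i, j, c) \<in> full"
  shows "h \<otimes> t i j c = t i j c \<otimes> h"
proof -
  have IJ: "form_ideal R (I, \<Gamma>)" "form_ideal R (J, \<Delta>)"
    using kill by (simp_all add: kills_product_def)
  have "opposite_commutators n (I, \<Gamma>) (J, \<Delta>) \<subseteq> {g \<in> carrier Q. t i j c \<otimes> g = g \<otimes> t i j c}"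
  proof
    fix g assume g: "g \<in> opposite_commutators n (I, \<Gamma>) (J, \<Delta>)"
    then obtain k l a b where g_eq: "g = Q.commutator (t k l a) (t l k b)"
      and kl: "k \<in> Om m" "l \<in> Om m" "k \<noteq> l"
      and ab: "a \<in> component R (I, \<Gamma>) k l" "b \<in> component R (J, \<Delta>) l k"
      using n(1) by (auto simp: opposite_commutators_def Om_iff simp del: component.simps)
    have "g \<otimes> t i j c = t i j c \<otimes> g"
    proof (cases "l = - k")
      case True
      show ?thesis
        unfolding g_eq True
        by (rule long_commutator_central[OF kill n(2) _ _ kl(1) z]) (use ab True in simp_all)
    next
      case False
      show ?thesis
        unfolding g_eq
        by (rule short_commutator_central[OF kill _ _ n(2) kl(1,2) _ z]) (use ab False kl in auto)
    qed
    then show "g \<in> {g \<in> carrier Q. t i j c \<otimes> g = g \<otimes> t i j c}"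
      using g opposite_commutators_closed[OF IJ n(1)] by auto
  qed
  then have "h \<in> {g \<in> carrier Q. t i j c \<otimes> g = g \<otimes> t i j c}"
    using Q.generate_subgroup_incl[OF _ Q.subgroup_centralizer[OF t_closed[OF z]]] h by blast
  then show ?thesis by simp
qed

lemma image_FU:
  assumes "form_ideal R X"
  shows "\<phi> ` FU R m X = generate Q ((\<lambda>(i, j, a). t i j a) ` elem_params R m X)"
proof -
  let ?A = "(\<lambda>(i, j, a). T R m i j a) ` elem_params R m X"
  have A: "?A \<subseteq> EU_abs R m" using params_full[OF assms] T_in_EU_abs by auto
  have "FU R m X = generate ((GL m)\<lparr>carrier := EU_abs R m\<rparr>) ?A"
    unfolding FU_eq by (rule group.generate_consistent[OF group_GL A subgroup_EU_abs, symmetric])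
  moreover have "\<phi> ` ?A = (\<lambda>(i, j, a). t i j a) ` elem_params R m X"
    by (force simp: t_def image_image split_def)
  ultimately show ?thesis using \<phi>.generate_img[of ?A] A by simp
qed

lemma commutator_FU_stable:
  assumes kill: "kills_product (I, \<Gamma>) (J, \<Delta>)" and n: "m = Suc n" "2 \<le> n"
    and x: "x \<in> FU R m (I, \<Gamma>)" and y: "y \<in> FU R m (J, \<Delta>)"
  shows "Q.commutator (\<phi> x) (\<phi> y) \<in> generate Q (opposite_commutators n (I, \<Gamma>) (J, \<Delta>))"
proof -
  have I: "form_ideal R (I, \<Gamma>)" and J: "form_ideal R (J, \<Delta>)"
    using kill by (simp_all add: kills_product_def)
  let ?H = "generate Q (opposite_commutators n (I, \<Gamma>) (J, \<Delta>))"
  let ?A = "\<lambda>X. (\<lambda>(i, j, a). t i j a) ` elem_params R m X"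
  have nm: "n \<le> m" "3 \<le> m" using n by auto
  have H: "subgroup ?H Q"
    by (rule Q.generate_is_subgroup[OF opposite_commutators_closed[OF I J nm(1)]])
  have A: "?A (I, \<Gamma>) \<subseteq> carrier Q" "?A (J, \<Delta>) \<subseteq> carrier Q"
    using params_full[OF I] params_full[OF J] t_closed by auto
  show ?thesis
  proof (rule Q.commutators_in_central_subgroup[OF H A])
    show "Q.commutator s u \<in> ?H" if "s \<in> ?A (I, \<Gamma>)" "u \<in> ?A (J, \<Delta>)" for s u
      using that gen_commutator_stable[OF kill n] by (auto simp del: elem_params_iff)
    show "\<phi> x \<in> generate Q (?A (I, \<Gamma>))" "\<phi> y \<in> generate Q (?A (J, \<Delta>))"
      using image_FU[OF I] image_FU[OF J] x y by blast+
    fix h z assume h: "h \<in> ?H" and z: "z \<in> generate Q (?A (I, \<Gamma>)) \<union> generate Q (?A (J, \<Delta>))"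
    have hc: "h \<in> carrier Q" using h subgroup.mem_carrier[OF H] by blast
    have "?A X \<subseteq> {g \<in> carrier Q. h \<otimes> g = g \<otimes> h}" if "form_ideal R X" for X
      using params_full[OF that] t_closed generated_commutators_central[OF kill nm h]
      by (auto simp del: elem_params_iff)
    then have "generate Q (?A X) \<subseteq> {g \<in> carrier Q. h \<otimes> g = g \<otimes> h}" if "form_ideal R X" for X
      using that by (intro Q.generate_subgroup_incl Q.subgroup_centralizer[OF hc])
    then show "h \<otimes> z = z \<otimes> h" using z I J by blast
  qed
qed

end

section \<open>The image of the mixed commutator subgroup\<close>

context form_ring
begin

lemma group_EU_abs: "group ((GL n)\<lparr>carrier := EU_abs R n\<rparr>)"
  by (rule group.subgroup_imp_group[OF group_GL subgroup_EU_abs])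

lemma GL_commutator_in_EU_abs:
  assumes "x \<in> EU_abs R n" "y \<in> EU_abs R n"
  shows "x \<otimes>\<^bsub>GL n\<^esub> y \<otimes>\<^bsub>GL n\<^esub> inv\<^bsub>GL n\<^esub> x \<otimes>\<^bsub>GL n\<^esub> inv\<^bsub>GL n\<^esub> y \<in> EU_abs R n"
  using assms subgroup.m_closed[OF subgroup_EU_abs] subgroup.m_inv_closed[OF subgroup_EU_abs]
  by simp

lemma FU_form_ideal_subset: "form_ideal R (I, \<Gamma>) \<Longrightarrow> FU R n (I, \<Gamma>) \<subseteq> EU_abs R n"
  by (rule FU_subset_EU_abs) (simp only: snd_conv form_idealD(8))

lemma stab_FU:
  "stab n ` FU R n X \<subseteq> FU R (Suc n) X"
  unfolding FU_eq[of R n]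
proof (rule group_hom_generate_subset[OF _ elem_gens_in_GL _ subgroup_FU])
  show "group_hom (GL n) (GL (Suc n)) (stab n :: 'a imat \<Rightarrow> _)"
    using stab_hom[of n] by (intro group_hom.intro group_hom_axioms.intro group_GL) simp
  show "stab n ` (\<lambda>(i, j, a). T R n i j a) ` elem_params R n X \<subseteq> FU R (Suc n) X"
  proof clarify
    fix i j a assume a: "(i, j, a) \<in> elem_params R n X"
    then have "stab n (T R n i j a) = T R (Suc n) i j a" using stab_T[of i n j R a] by simp
    moreover have "(i, j, a) \<in> elem_params R (Suc n) X" using a Om_Suc by simp
    ultimately show "stab n (T R n i j a) \<in> FU R (Suc n) X"
      unfolding FU_eq by (metis (no_types, lifting) case_prod_conv generate.incl image_eqI)
  qed
qed

lemma stab_FU_comm: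
  "stab n ` FU_comm R n X Y \<subseteq> FU_comm R (Suc n) X Y"
proof -
  interpret st: group_hom "GL n :: 'a imat monoid" "GL (Suc n)" "stab n"
    using stab_hom[of n] by (intro group_hom.intro group_hom_axioms.intro group_GL) simp
  let ?gens = "\<lambda>k. {x \<otimes>\<^bsub>GL k\<^esub> y \<otimes>\<^bsub>GL k\<^esub> inv\<^bsub>GL k\<^esub> x \<otimes>\<^bsub>GL k\<^esub> inv\<^bsub>GL k\<^esub> y | x y.
      x \<in> FU R k X \<and> y \<in> FU R k Y}"
  have carrier: "z \<in> carrier (GL k)" if "z \<in> FU R k W" for z k W
    using that subgroup.mem_carrier[OF subgroup_FU] by blast
  have gens: "?gens k \<subseteq> carrier (GL k)" for k
  proof safe
    fix x y assume xy: "x \<in> FU R k X" "y \<in> FU R k Y"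
    show "x \<otimes>\<^bsub>GL k\<^esub> y \<otimes>\<^bsub>GL k\<^esub> inv\<^bsub>GL k\<^esub> x \<otimes>\<^bsub>GL k\<^esub> inv\<^bsub>GL k\<^esub> y \<in> carrier (GL k)"
      by (intro monoid.m_closed[OF group.is_monoid[OF group_GL]] group.inv_closed[OF group_GL]
          carrier[OF xy(1)] carrier[OF xy(2)])
  qed
  show ?thesis
    unfolding commutator_subgroup_def
  proof (rule group_hom_generate_subset[OF st.group_hom_axioms gens])
    show "subgroup (generate (GL (Suc n)) (?gens (Suc n))) (GL (Suc n))"
      by (rule group.generate_is_subgroup[OF group_GL gens])
    show "stab n ` ?gens n \<subseteq> generate (GL (Suc n)) (?gens (Suc n))"
    proof safe
      fix x y assume xy: "x \<in> FU R n X" "y \<in> FU R n Y"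
      have "stab n x \<in> FU R (Suc n) X" "stab n y \<in> FU R (Suc n) Y"
        using stab_FU xy by blast+
      then show "stab n (x \<otimes>\<^bsub>GL n\<^esub> y \<otimes>\<^bsub>GL n\<^esub> inv\<^bsub>GL n\<^esub> x \<otimes>\<^bsub>GL n\<^esub> inv\<^bsub>GL n\<^esub> y)
          \<in> generate (GL (Suc n)) (?gens (Suc n))"
        using carrier[OF xy(1)] carrier[OF xy(2)] by (intro generate.incl) auto
    qed
  qed
qed

lemma FU_comm_gens_subset:
  assumes "form_ideal R (I, \<Gamma>)" "form_ideal R (J, \<Delta>)"
  shows "{x \<otimes>\<^bsub>GL n\<^esub> y \<otimes>\<^bsub>GL n\<^esub> inv\<^bsub>GL n\<^esub> x \<otimes>\<^bsub>GL n\<^esub> inv\<^bsub>GL n\<^esub> y | x y.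
      x \<in> FU R n (I, \<Gamma>) \<and> y \<in> FU R n (J, \<Delta>)} \<subseteq> EU_abs R n"
proof -
  have "FU R n (I, \<Gamma>) \<subseteq> EU_abs R n" "FU R n (J, \<Delta>) \<subseteq> EU_abs R n"
    by (intro FU_form_ideal_subset assms)+
  then show ?thesis using GL_commutator_in_EU_abs by blast
qed

lemma FU_comm_subset:
  assumes "form_ideal R (I, \<Gamma>)" "form_ideal R (J, \<Delta>)"
  shows "FU_comm R n (I, \<Gamma>) (J, \<Delta>) \<subseteq> EU_abs R n"
  unfolding commutator_subgroup_def
  by (rule group.generate_subgroup_incl[OF group_GL FU_comm_gens_subset[OF assms] subgroup_EU_abs])

lemma subgroup_FU_comm:
  assumes "form_ideal R (I, \<Gamma>)" "form_ideal R (J, \<Delta>)"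
  shows "subgroup (FU_comm R n (I, \<Gamma>) (J, \<Delta>)) (GL n)"
  unfolding commutator_subgroup_def
  by (intro group.generate_is_subgroup[OF group_GL] order_trans[OF FU_comm_gens_subset[OF assms]]
      subgroup.subset[OF subgroup_EU_abs])

end

context elementary_hom
begin

lemma \<phi>_commutator:
  assumes "x \<in> EU_abs R m" "y \<in> EU_abs R m"
  shows "\<phi> (x \<otimes>\<^bsub>GL m\<^esub> y \<otimes>\<^bsub>GL m\<^esub> inv\<^bsub>GL m\<^esub> x \<otimes>\<^bsub>GL m\<^esub> inv\<^bsub>GL m\<^esub> y) = Q.commutator (\<phi> x) (\<phi> y)"
proof -
  let ?E = "(GL m)\<lparr>carrier := EU_abs R m\<rparr>"
  have inv: "inv\<^bsub>GL m\<^esub> z = inv\<^bsub>?E\<^esub> z" if "z \<in> EU_abs R m" for z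
    by (rule group.m_inv_consistent[OF group_GL subgroup_EU_abs that, symmetric])
  have "\<phi> (x \<otimes>\<^bsub>?E\<^esub> y \<otimes>\<^bsub>?E\<^esub> inv\<^bsub>?E\<^esub> x \<otimes>\<^bsub>?E\<^esub> inv\<^bsub>?E\<^esub> y) = Q.commutator (\<phi> x) (\<phi> y)"
  proof -
    have "x \<in> carrier ?E" "y \<in> carrier ?E" using assms by simp_all
    then show ?thesis
      unfolding Q.commutator_def
      by (simp only: \<phi>.hom_mult \<phi>.hom_inv \<phi>.G.m_closed \<phi>.G.inv_closed)
  qed
  then show ?thesis using assms by (simp add: inv)
qed

text \<open>Between the two sides lies the subgroup generated by the elementary commutators with indices
  in \<open>Om n\<close>: it contains the left-hand side by centrality and moving of indices, and each of its generators
  is visibly the image of a stabilised commutator.\<close>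

theorem image_FU_comm_stable:
  assumes kill: "kills_product (I, \<Gamma>) (J, \<Delta>)" and n: "m = Suc n" "2 \<le> n"
  shows "\<phi> ` FU_comm R m (I, \<Gamma>) (J, \<Delta>) \<subseteq> \<phi> ` stab n ` FU_comm R n (I, \<Gamma>) (J, \<Delta>)"
proof -
  have I: "form_ideal R (I, \<Gamma>)" and J: "form_ideal R (J, \<Delta>)"
    using kill by (simp_all add: kills_product_def)
  let ?gens = "\<lambda>k. {x \<otimes>\<^bsub>GL k\<^esub> y \<otimes>\<^bsub>GL k\<^esub> inv\<^bsub>GL k\<^esub> x \<otimes>\<^bsub>GL k\<^esub> inv\<^bsub>GL k\<^esub> y | x y.
      x \<in> FU R k (I, \<Gamma>) \<and> y \<in> FU R k (J, \<Delta>)}"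
  let ?H = "generate Q (opposite_commutators n (I, \<Gamma>) (J, \<Delta>))"
  interpret st: group_hom "GL n :: 'a imat monoid" "GL m" "stab n"
    using stab_hom[of n] n by (intro group_hom.intro group_hom_axioms.intro group_GL) simp
  have FU: "FU R m (I, \<Gamma>) \<subseteq> EU_abs R m" "FU R m (J, \<Delta>) \<subseteq> EU_abs R m"
    by (intro FU_form_ideal_subset I J)+
  have H: "subgroup ?H Q"
    using n by (intro Q.generate_is_subgroup opposite_commutators_closed I J) simp
  have "\<phi> ` FU_comm R m (I, \<Gamma>) (J, \<Delta>) = \<phi> ` generate ((GL m)\<lparr>carrier := EU_abs R m\<rparr>) (?gens m)"
    unfolding commutator_subgroup_def
    using group.generate_consistent[OF group_GL FU_comm_gens_subset[OF I J] subgroup_EU_abs] by simp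
  also have "\<dots> \<subseteq> ?H"
  proof (rule group_hom_generate_subset[OF \<phi>.group_hom_axioms _ _ H])
    show "?gens m \<subseteq> carrier ((GL m)\<lparr>carrier := EU_abs R m\<rparr>)"
      using FU_comm_gens_subset[OF I J] by simp
    show "\<phi> ` ?gens m \<subseteq> ?H"
    proof safe
      fix x y assume xy: "x \<in> FU R m (I, \<Gamma>)" "y \<in> FU R m (J, \<Delta>)"
      then show "\<phi> (x \<otimes>\<^bsub>GL m\<^esub> y \<otimes>\<^bsub>GL m\<^esub> inv\<^bsub>GL m\<^esub> x \<otimes>\<^bsub>GL m\<^esub> inv\<^bsub>GL m\<^esub> y) \<in> ?H"
        using \<phi>_commutator[of x y] FU commutator_FU_stable[OF kill n xy] by (simp add: subsetD)
    qed
  qed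
  also have "?H \<subseteq> \<phi> ` stab n ` FU_comm R n (I, \<Gamma>) (J, \<Delta>)"
  proof (rule Q.generate_subgroup_incl)
    have "stab n ` FU_comm R n (I, \<Gamma>) (J, \<Delta>) \<subseteq> EU_abs R m"
      using stab_FU_comm[of n "(I, \<Gamma>)" "(J, \<Delta>)"] FU_comm_subset[OF I J, of m] n(1) by blast
    then have "subgroup (stab n ` FU_comm R n (I, \<Gamma>) (J, \<Delta>)) ((GL m)\<lparr>carrier := EU_abs R m\<rparr>)"
      by (intro group.subgroup_incl[OF group_GL] st.subgroup_img_is_subgroup subgroup_FU_comm I J
          subgroup_EU_abs)
    then show "subgroup (\<phi> ` stab n ` FU_comm R n (I, \<Gamma>) (J, \<Delta>)) Q"
      by (rule \<phi>.subgroup_img_is_subgroup)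
    show "opposite_commutators n (I, \<Gamma>) (J, \<Delta>) \<subseteq> \<phi> ` stab n ` FU_comm R n (I, \<Gamma>) (J, \<Delta>)"
    proof
      fix g assume "g \<in> opposite_commutators n (I, \<Gamma>) (J, \<Delta>)"
      then obtain i j a b where g: "g = Q.commutator (t i j a) (t j i b)"
        and ab: "(i, j, a) \<in> elem_params R n (I, \<Gamma>)" "(j, i, b) \<in> elem_params R n (J, \<Delta>)"
        unfolding opposite_commutators_def by blast
      have Om: "i \<in> Om n" "j \<in> Om n" "i \<noteq> j" using ab(1) by (auto simp del: component.simps)
      let ?x = "T R n i j a" and ?y = "T R n j i b"
      have FU: "?x \<in> FU R n (I, \<Gamma>)" "?y \<in> FU R n (J, \<Delta>)"
        unfolding FU_eq using ab by (auto intro!: generate.incl rev_image_eqI simp del: elem_params_iff)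
      have stab_xy: "stab n ?x = T R m i j a" "stab n ?y = T R m j i b"
        using stab_T Om n(1) by auto
      have "(i, j, a) \<in> elem_params R m (I, \<Gamma>)" "(j, i, b) \<in> elem_params R m (J, \<Delta>)"
        using ab n(1) Om_Suc by (simp_all del: component.simps)
      then have E: "T R m i j a \<in> EU_abs R m" "T R m j i b \<in> EU_abs R m"
        using params_full I J T_in_EU_abs by blast+
      let ?c = "?x \<otimes>\<^bsub>GL n\<^esub> ?y \<otimes>\<^bsub>GL n\<^esub> inv\<^bsub>GL n\<^esub> ?x \<otimes>\<^bsub>GL n\<^esub> inv\<^bsub>GL n\<^esub> ?y"
      have "?c \<in> FU_comm R n (I, \<Gamma>) (J, \<Delta>)"
        unfolding commutator_subgroup_def using FU by (intro generate.incl) blast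
      moreover have "\<phi> (stab n ?c) = g"
        using \<phi>_commutator[OF E] T_in_GL[OF Om, of a] T_in_GL[of j n i b] Om
        unfolding g t_def by (simp add: stab_xy)
      ultimately show "g \<in> \<phi> ` stab n ` FU_comm R n (I, \<Gamma>) (J, \<Delta>)" by blast
    qed
  qed
  finally show ?thesis .
qed

end

section \<open>The stability map\<close>

lemma normal_normal_closure:
  assumes "group G" "S \<subseteq> carrier G"
  shows "normal_closure G S \<lhd> G"
proof -
  interpret group G by fact
  let ?A = "{N. N \<lhd> G \<and> S \<subseteq> N}"
  have "carrier G \<in> ?A"
    using assms(2) subgroup_self normal_inv_iff by auto
  then have "subgroup (\<Inter> ?A) G"
    by (intro subgroups_Inter) (auto intro: normal_imp_subgroup)
  moreover have "x \<otimes>\<^bsub>G\<^esub> h \<otimes>\<^bsub>G\<^esub> inv\<^bsub>G\<^esub> x \<in> \<Inter> ?A" if "x \<in> carrier G" "h \<in> \<Inter> ?A" for x h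
    using that normal_inv_iff by auto
  ultimately show ?thesis
    unfolding normal_closure_def normal_inv_iff by blast
qed

lemma normal_closure_incl: "S \<subseteq> normal_closure G S"
  unfolding normal_closure_def by blast

lemma normal_closure_least: "N \<lhd> G \<Longrightarrow> S \<subseteq> N \<Longrightarrow> normal_closure G S \<subseteq> N"
  unfolding normal_closure_def by blast

context form_ring
begin

lemma EU_normal:
  assumes "snd Z \<subseteq> Lam R"
  shows "EU R n Z \<lhd> (GL n)\<lparr>carrier := EU_abs R n\<rparr>"
  unfolding EU_def using FU_subset_EU_abs[OF assms] by (intro normal_normal_closure group_EU_abs) simp

lemma FU_subset_EU: "FU R n X \<subseteq> EU R n X"
  unfolding EU_def by (rule normal_closure_incl)

text \<open>Stabilisation followed by the projection modulo the relative elementary subgroup is a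
  homomorphism on the elementary group. Its kernel is normal and contains the generators, hence it
  contains their normal closure.\<close>

lemma stab_EU:
  assumes "snd Z \<subseteq> Lam R"
  shows "stab n ` EU R n Z \<subseteq> EU R (Suc n) Z"
proof -
  let ?E = "\<lambda>k. (GL k)\<lparr>carrier := EU_abs R k\<rparr> :: 'a imat monoid"
  let ?\<psi> = "(\<lambda>x. EU R (Suc n) Z #>\<^bsub>?E (Suc n)\<^esub> x) \<circ> stab n"
  interpret N': normal "EU R (Suc n) Z" "?E (Suc n)" by (rule EU_normal[OF assms])
  have stab_E: "stab n \<in> hom (?E n) (?E (Suc n))"
  proof (rule homI)
    show "stab n x \<in> carrier (?E (Suc n))" if "x \<in> carrier (?E n)" for x
      using that stab_FU[of n "(UNIV, Lam R)"] by (auto simp: EU_abs_def)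
    show "stab n (x \<otimes>\<^bsub>?E n\<^esub> y) = stab n x \<otimes>\<^bsub>?E (Suc n)\<^esub> stab n y" for x y
      using stab_mat_monoid(2)[of n x y] by (simp add: mult_GL)
  qed
  then have "?\<psi> \<in> hom (?E n) (?E (Suc n) Mod EU R (Suc n) Z)"
    using N'.r_coset_hom_Mod by (rule hom_compose)
  then interpret \<psi>: group_hom "?E n" "?E (Suc n) Mod EU R (Suc n) Z" ?\<psi>
    by (intro group_hom.intro group_hom_axioms.intro group_EU_abs N'.factorgroup_is_group)
  have mem: "stab n x \<in> EU R (Suc n) Z \<longleftrightarrow> x \<in> kernel (?E n) (?E (Suc n) Mod EU R (Suc n) Z) ?\<psi>"
    if x: "x \<in> EU_abs R n" for x
  proof -
    have sx: "stab n x \<in> carrier (?E (Suc n))"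
      using hom_in_carrier[OF stab_E] x by simp
    show ?thesis
      using x N'.rcos_const[OF N'.is_group] N'.rcos_self[OF sx N'.is_subgroup]
      by (auto simp: kernel_def)
  qed
  have "FU R n Z \<subseteq> kernel (?E n) (?E (Suc n) Mod EU R (Suc n) Z) ?\<psi>"
  proof
    fix x assume x: "x \<in> FU R n Z"
    then have "stab n x \<in> EU R (Suc n) Z"
      by (intro subsetD[OF FU_subset_EU] subsetD[OF stab_FU] imageI)
    then show "x \<in> kernel (?E n) (?E (Suc n) Mod EU R (Suc n) Z) ?\<psi>"
      using mem x FU_subset_EU_abs[OF assms] by blast
  qed
  then have "EU R n Z \<subseteq> kernel (?E n) (?E (Suc n) Mod EU R (Suc n) Z) ?\<psi>"
    unfolding EU_def[of R n] by (rule normal_closure_least[OF \<psi>.normal_kernel])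
  moreover have "EU R n Z \<subseteq> EU_abs R n"
    using normal_imp_subgroup[OF EU_normal[OF assms, of n]] subgroup.subset by fastforce
  ultimately show ?thesis using mem by blast
qed

end

theorem theorem9:
  fixes R :: "('a::{ring, monoid_mult}) form_data"
    and I \<Gamma> J \<Delta> :: "'a set"
    and n :: nat
  assumes "form_ring R"
    and "form_ideal R (I, \<Gamma>)"
    and "form_ideal R (J, \<Delta>)"
    and "n \<ge> 3"
  shows "(\<forall>g \<in> FU_comm R n (I, \<Gamma>) (J, \<Delta>).
            stability_map R n (I, \<Gamma>) (J, \<Delta>)
                (EU R n (sym_prod R (I, \<Gamma>) (J, \<Delta>)) #>\<^bsub>GL n\<^esub> g)
              = EU R (n + 1) (sym_prod R (I, \<Gamma>) (J, \<Delta>)) #>\<^bsub>GL (n + 1)\<^esub> stab n g)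
       \<and> stability_map R n (I, \<Gamma>) (J, \<Delta>)
            \<in> epi (FU_quotient R n (I, \<Gamma>) (J, \<Delta>)) (FU_quotient R (n + 1) (I, \<Gamma>) (J, \<Delta>))"
proof -
  interpret form_ring R by fact
  let ?X = "(I, \<Gamma>)" and ?Y = "(J, \<Delta>)"
  define Z where "Z = sym_prod R ?X ?Y"
  let ?E = "\<lambda>k. (GL k)\<lparr>carrier := EU_abs R k\<rparr> :: 'a imat monoid"
  let ?N = "EU R n Z" and ?M = "EU R (n + 1) Z"
  let ?C = "\<lambda>k. FU_comm R k ?X ?Y" and ?s = "stability_map R n ?X ?Y"
  have Z: "snd Z \<subseteq> Lam R" unfolding Z_def by (rule sym_prod_Lam[OF assms(2,3)])
  interpret N: normal ?N "?E n" by (rule EU_normal[OF Z])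
  interpret M: normal ?M "?E (n + 1)" by (rule EU_normal[OF Z])
  interpret Q: group "?E (n + 1) Mod ?M" by (rule M.factorgroup_is_group)
  interpret elementary_hom R "?E (n + 1) Mod ?M" "n + 1" "\<lambda>x. ?M #>\<^bsub>?E (n + 1)\<^esub> x"
    by unfold_locales (rule M.r_coset_hom_Mod)
  have kill: "kills_product ?X ?Y"
    unfolding kills_product_def Z_def[symmetric]
  proof (intro conjI assms(2,3), clarify)
    fix i j a assume a: "(i, j, a) \<in> elem_params R (n + 1) Z"
    then have "T R (n + 1) i j a \<in> FU R (n + 1) Z"
      unfolding FU_eq by (metis (no_types, lifting) case_prod_conv generate.incl image_eqI)
    then have "T R (n + 1) i j a \<in> ?M" by (rule subsetD[OF FU_subset_EU])
    then show "t i j a = \<one>\<^bsub>?E (n + 1) Mod ?M\<^esub>"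
      unfolding t_def by (simp only: one_FactGroup M.rcos_const[OF M.is_group])
  qed
  have C: "?C k \<subseteq> EU_abs R k" for k by (rule FU_comm_subset[OF assms(2,3)])
  have stab_E: "stab n x \<in> EU_abs R (n + 1)" if "x \<in> EU_abs R n" for x
    using that stab_FU[of n "(UNIV, Lam R)"] by (auto simp: EU_abs_def)
  have stab_mult: "stab n (x \<otimes>\<^bsub>GL n\<^esub> y) = stab n x \<otimes>\<^bsub>GL (n + 1)\<^esub> stab n y" for x y :: "'a imat"
    using stab_mat_monoid(2)[of n x y] by (simp add: mult_GL)
  have map: "?s (?N #>\<^bsub>GL n\<^esub> g) = ?M #>\<^bsub>GL (n + 1)\<^esub> stab n g" if g: "g \<in> ?C n" for g
  proof -
    have gE: "g \<in> carrier (?E n)" using g C by auto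
    have "?M #>\<^bsub>GL (n + 1)\<^esub> stab n h = ?M #>\<^bsub>GL (n + 1)\<^esub> stab n g" if h: "h \<in> ?N #>\<^bsub>GL n\<^esub> g" for h
    proof -
      obtain x where x: "x \<in> ?N" "h = x \<otimes>\<^bsub>GL n\<^esub> g" using h by (auto simp: r_coset_def)
      have "stab n x \<in> ?M" using stab_EU[OF Z, of n] x(1) by auto
      then have "?M #>\<^bsub>?E (n + 1)\<^esub> stab n x = ?M" "stab n x \<in> carrier (?E (n + 1))"
        using M.rcos_const[OF M.is_group] M.mem_carrier by blast+
      moreover have "stab n g \<in> carrier (?E (n + 1))" using gE stab_E by simp
      ultimately show ?thesis
        using M.coset_mult_assoc[OF M.subset, of "stab n x" "stab n g"] x(2)
        by (simp add: stab_mult)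
    qed
    moreover have "g \<in> ?N #>\<^bsub>GL n\<^esub> g"
      using N.rcos_self[OF gE N.is_subgroup] by simp
    ultimately have "(\<lambda>g. ?M #>\<^bsub>GL (n + 1)\<^esub> stab n g) ` (?N #>\<^bsub>GL n\<^esub> g)
        = {?M #>\<^bsub>GL (n + 1)\<^esub> stab n g}"
      by blast
    then show ?thesis
      unfolding stability_map_def Z_def[symmetric] by (simp only: the_elem_eq)
  qed
  have carrier: "carrier (FU_quotient R k ?X ?Y) = (\<lambda>x. EU R k Z #>\<^bsub>GL k\<^esub> x) ` ?C k" for k
    unfolding FU_quotient_def carrier_FactGroup Z_def by simp
  have mult: "A \<otimes>\<^bsub>FU_quotient R k ?X ?Y\<^esub> B = A <#>\<^bsub>GL k\<^esub> B" for k A B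
    unfolding FU_quotient_def mult_FactGroup by simp
  have stab_C: "stab n g \<in> ?C (n + 1)" if "g \<in> ?C n" for g
    using stab_FU_comm[of n ?X ?Y] that by auto
  have hom: "?s \<in> hom (FU_quotient R n ?X ?Y) (FU_quotient R (n + 1) ?X ?Y)"
  proof (rule homI)
    fix A assume "A \<in> carrier (FU_quotient R n ?X ?Y)"
    then show "?s A \<in> carrier (FU_quotient R (n + 1) ?X ?Y)"
      unfolding carrier using map stab_C by auto
  next
    fix A B assume "A \<in> carrier (FU_quotient R n ?X ?Y)" "B \<in> carrier (FU_quotient R n ?X ?Y)"
    then obtain g h where g: "g \<in> ?C n" "A = ?N #>\<^bsub>GL n\<^esub> g" and h: "h \<in> ?C n" "B = ?N #>\<^bsub>GL n\<^esub> h"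
      unfolding carrier by blast
    have gh: "g \<otimes>\<^bsub>GL n\<^esub> h \<in> ?C n"
      using subgroup.m_closed[OF subgroup_FU_comm[OF assms(2,3)] g(1) h(1)] .
    have "A <#>\<^bsub>GL n\<^esub> B = ?N #>\<^bsub>GL n\<^esub> (g \<otimes>\<^bsub>GL n\<^esub> h)"
      using N.rcos_sum[of g h] g h C by auto
    then have "?s (A \<otimes>\<^bsub>FU_quotient R n ?X ?Y\<^esub> B) = ?M #>\<^bsub>GL (n + 1)\<^esub> (stab n g \<otimes>\<^bsub>GL (n + 1)\<^esub> stab n h)"
      using map[OF gh] by (simp add: mult stab_mult)
    also have "\<dots> = (?M #>\<^bsub>GL (n + 1)\<^esub> stab n g) <#>\<^bsub>GL (n + 1)\<^esub> (?M #>\<^bsub>GL (n + 1)\<^esub> stab n h)"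
      using M.rcos_sum[of "stab n g" "stab n h"] g h C stab_E by auto
    finally show "?s (A \<otimes>\<^bsub>FU_quotient R n ?X ?Y\<^esub> B) = ?s A \<otimes>\<^bsub>FU_quotient R (n + 1) ?X ?Y\<^esub> ?s B"
      using map g h by (simp add: mult)
  qed
  have "carrier (FU_quotient R (n + 1) ?X ?Y) \<subseteq> ?s ` carrier (FU_quotient R n ?X ?Y)"
  proof
    fix A assume "A \<in> carrier (FU_quotient R (n + 1) ?X ?Y)"
    then obtain g' where g': "g' \<in> ?C (n + 1)" "A = ?M #>\<^bsub>GL (n + 1)\<^esub> g'"
      unfolding carrier by blast
    then have "A \<in> (\<lambda>x. ?M #>\<^bsub>?E (n + 1)\<^esub> x) ` ?C (n + 1)" by auto
    also have "\<dots> \<subseteq> (\<lambda>x. ?M #>\<^bsub>?E (n + 1)\<^esub> x) ` stab n ` ?C n"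
      using assms(4) by (intro image_FU_comm_stable[OF kill]) auto
    finally obtain g where "g \<in> ?C n" "A = ?M #>\<^bsub>GL (n + 1)\<^esub> stab n g" by auto
    then show "A \<in> ?s ` carrier (FU_quotient R n ?X ?Y)"
      unfolding carrier using map by auto
  qed
  with hom map show ?thesis by (simp only: Z_def[symmetric] epi_iff_subset) blast
qed

end
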